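(* Let $B$ be a bidirected multigraph with signing $\sigma$, let $X \subseteq V(B)$ be a vertex set, and let $k$ be a non-negative integer. Then $B$ admits a set of $k$ pairwise vertex-disjoint $X$-paths if and only if for every pair of vertex sets $S, T \subseteq V(B)$ with $X \cap S = X \cap T$ we have $$|S \cap T| + \sum_{C \in \mathcal{C}(B_{S,T})} \left\lfloor \tfrac{1}{2} |V(C) \cap (X \cup S \cup T)| \right\rfloor \geq k,$$ where $B_{S,T}$ is the undirected multigraph with vertex set $V(B)$ whose edge set consists of those edges $e$ of $B$ such that each endvertex $v$ of $e$ satisfies one of: $v \notin S \cup T$; or $v \in S \setminus T$ and $\sigma(v,e) = -$; or $v \in T \setminus S$ and $\sigma(v,e) = +$; and $\mathcal{C}(B_{S,T})$ denotes the set of connected components of $B_{S,T}$.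
   Context: A bidirected multigraph $B$ is a pair $(G,\sigma)$ where $G=(V,E)$ is a finite multigraph without loops (multiple edges allowed) and $\sigma$ is a signing assigning to each half-edge $(v,e)$ (with $v$ an endvertex of the edge $e$) a sign $\sigma(v,e) \in \{+,-\}$. We write $V(B)=V$, $E(B)=E$. A path in $B$ is a path $P = v_0 e_1 v_1 \dots e_\ell v_\ell$ in the underlying multigraph $G$ (distinct vertices) such that at each internal vertex the two half-edges of $P$ there have distinct signs, i.e. $\sigma(v_i, e_i) \neq \sigma(v_i, e_{i+1})$ for all $i \in \{1,\dots,\ell-1\}$. A path is trivial if $\ell = 0$. For $X \subseteq V(B)$, an $X$-path in $B$ is a non-trivial path in $B$ whose two endvertices lie in $X$ and none of whose other vertices lies in $X$. Paths are disjoint if they share no vertex. *)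

theory Defs
  imports Main
begin

text \<open>A finite loopless multigraph. The edges are abstract objects, so parallel edges are allowed;
  the values of \<open>ends\<close> outside \<open>edges\<close> are irrelevant.\<close>

record ('v, 'e) multigraph =
  verts :: "'v set"
  edges :: "'e set"
  ends  :: "'e \<Rightarrow> 'v set"

definition finite_multigraph :: "('v, 'e) multigraph \<Rightarrow> bool" where
  "finite_multigraph G \<longleftrightarrow>
     finite (verts G) \<and> finite (edges G) \<and>
     (\<forall>e\<in>edges G. ends G e \<subseteq> verts G \<and> card (ends G e) = 2)"

text \<open>A bidirected multigraph is a finite multigraph \<open>G\<close> together with a signing \<open>\<sigma>\<close>, where
  \<open>\<sigma> v e\<close> is the sign of the half-edge \<open>(v, e)\<close>. The signing is a total function; only its values
  for \<open>e \<in> edges G\<close> and \<open>v \<in> ends G e\<close> ever matter.\<close>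

datatype sign = Plus | Minus

type_synonym ('v, 'e) signing = "'v \<Rightarrow> 'e \<Rightarrow> sign"

text \<open>The path \<open>v\<^sub>0 e\<^sub>1 v\<^sub>1 \<dots> e\<^sub>l v\<^sub>l\<close> is represented by the lists \<open>[v\<^sub>0, \<dots>, v\<^sub>l]\<close> and
  \<open>[e\<^sub>1, \<dots>, e\<^sub>l]\<close>. List indexing starts at 0, so \<open>es ! i\<close> joins \<open>vs ! i\<close> and \<open>vs ! Suc i\<close>.\<close>

type_synonym ('v, 'e) mpath = "'v list \<times> 'e list"

definition is_path :: "('v, 'e) multigraph \<Rightarrow> ('v, 'e) mpath \<Rightarrow> bool" where
  "is_path G = (\<lambda>(vs, es).
     length vs = Suc (length es) \<and> distinct vs \<and>
     set vs \<subseteq> verts G \<and> set es \<subseteq> edges G \<and>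
     (\<forall>i<length es. ends G (es ! i) = {vs ! i, vs ! Suc i}))"

definition is_bipath ::
  "('v, 'e) multigraph \<Rightarrow> ('v, 'e) signing \<Rightarrow> ('v, 'e) mpath \<Rightarrow> bool" where
  "is_bipath G \<sigma> = (\<lambda>(vs, es).
     is_path G (vs, es) \<and>
     (\<forall>i. Suc i < length es \<longrightarrow>
        \<sigma> (vs ! Suc i) (es ! i) \<noteq> \<sigma> (vs ! Suc i) (es ! Suc i)))"

definition is_X_path ::
  "('v, 'e) multigraph \<Rightarrow> ('v, 'e) signing \<Rightarrow> 'v set \<Rightarrow> ('v, 'e) mpath \<Rightarrow> bool" where
  "is_X_path G \<sigma> X = (\<lambda>(vs, es).
     is_bipath G \<sigma> (vs, es) \<and> es \<noteq> [] \<and>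
     hd vs \<in> X \<and> last vs \<in> X \<and>
     (\<forall>i. 0 < i \<and> i < length es \<longrightarrow> vs ! i \<notin> X))"

definition disjoint_paths :: "('v, 'e) mpath set \<Rightarrow> bool" where
  "disjoint_paths \<P> \<longleftrightarrow> pairwise (\<lambda>P Q. disjnt (set (fst P)) (set (fst Q))) \<P>"

text \<open>A subgraph carries the same incidence function as the ambient graph, also outside of its own
  edge set. Hence equality of records is equality of vertex and edge sets, and no component is
  counted more than once.\<close>

definition is_subgraph :: "('v, 'e) multigraph \<Rightarrow> ('v, 'e) multigraph \<Rightarrow> bool" where
  "is_subgraph H G \<longleftrightarrow>
     verts H \<subseteq> verts G \<and> edges H \<subseteq> edges G \<and> ends H = ends G \<and>
     (\<forall>e\<in>edges H. ends H e \<subseteq> verts H)"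

definition connected_graph :: "('v, 'e) multigraph \<Rightarrow> bool" where
  "connected_graph H \<longleftrightarrow>
     verts H \<noteq> {} \<and>
     (\<forall>u\<in>verts H. \<forall>v\<in>verts H. \<exists>vs es. is_path H (vs, es) \<and> hd vs = u \<and> last vs = v)"

text \<open>The connected components are the maximal connected subgraphs.\<close>

definition components :: "('v, 'e) multigraph \<Rightarrow> ('v, 'e) multigraph set" where
  "components G = {C. is_subgraph C G \<and> connected_graph C \<and>
     (\<forall>D. is_subgraph D G \<and> connected_graph D \<and> is_subgraph C D \<longrightarrow> D = C)}"

text \<open>The undirected multigraph \<open>B\<^bsub>S,T\<^esub>\<close> for \<open>B = (G, \<sigma>)\<close>.\<close>

definition graph_ST ::
  "('v, 'e) multigraph \<Rightarrow> ('v, 'e) signing \<Rightarrow> 'v set \<Rightarrow> 'v set \<Rightarrow> ('v, 'e) multigraph" where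
  "graph_ST G \<sigma> S T =
     \<lparr>verts = verts G,
      edges = {e \<in> edges G. \<forall>v\<in>ends G e.
                 v \<notin> S \<union> T \<or> (v \<in> S - T \<and> \<sigma> v e = Minus) \<or> (v \<in> T - S \<and> \<sigma> v e = Plus)},
      ends = ends G\<rparr>"

end

theory Submission
  imports Defs
begin

text \<open>Split every vertex \<open>v \<notin> X\<close> into the two ports \<open>(v, Plus)\<close> and \<open>(v, Minus)\<close>, joined by an edge, keep
  the single port \<open>(x, Plus)\<close> for \<open>x \<in> X\<close> (the signs at \<open>X\<close> are irrelevant and may be taken to be
  \<open>Plus\<close>), and let an edge of \<open>B\<close> join the two ports given by its signs. Against the matching of all
  edges \<open>(v, Plus)(v, Minus)\<close>, the augmenting paths of this auxiliary graph are precisely the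
  \<open>X\<close>-paths of \<open>B\<close>, so \<open>k\<close> disjoint \<open>X\<close>-paths exist once there is a matching of size
  \<open>|V - X| + k\<close>. If the Tutte-Berge formula provides no such matching, then the port set \<open>U\<close> that it
  deletes yields a violating pair, where \<open>S\<close> and \<open>T\<close> consist of the vertices whose plus port,
  respectively minus port, lies in \<open>U\<close>.\<close>

section \<open>The Tutte-Berge formula\<close>

definition matching :: "'a set set \<Rightarrow> 'a set set \<Rightarrow> bool" where
  "matching E M \<longleftrightarrow> M \<subseteq> E \<and> pairwise disjnt M"

definition max_matching :: "'a set set \<Rightarrow> 'a set set \<Rightarrow> bool" where
  "max_matching E M \<longleftrightarrow> matching E M \<and> (\<forall>N. matching E N \<longrightarrow> card N \<le> card M)"

lemma card_Union_matching:
  assumes "pairwise disjnt M" "\<forall>e\<in>M. card e = 2"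
  shows "card (\<Union>M) = 2 * card M"
proof -
  have "card (\<Union>M) = sum card M"
    using assms by (intro card_Union_disjoint) (auto intro: card_ge_0_finite)
  then show ?thesis using assms by simp
qed

lemma ex_max_matching:
  assumes "finite E"
  shows "\<exists>M. max_matching E M"
proof -
  have "\<exists>M. matching E M \<and> (\<forall>N. matching E N \<longrightarrow> card N \<le> card M)"
  proof (rule ex_has_greatest_nat)
    show "matching E {}" by (simp add: matching_def)
    show "\<forall>M. matching E M \<longrightarrow> card M < Suc (card E)"
      using assms by (auto simp: matching_def less_Suc_eq_le intro: card_mono)
  qed
  then show ?thesis by (simp add: max_matching_def)
qed

lemma matching_subset: "matching E M \<Longrightarrow> N \<subseteq> M \<Longrightarrow> matching E N"
  unfolding matching_def by (meson pairwise_subset subset_trans)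

lemma matching_insert:
  "matching E M \<Longrightarrow> e \<in> E \<Longrightarrow> e \<inter> \<Union>M = {} \<Longrightarrow> matching E (insert e M)"
  unfolding matching_def pairwise_insert disjnt_def by blast

lemma matching_unique:
  "matching E M \<Longrightarrow> e \<in> M \<Longrightarrow> e' \<in> M \<Longrightarrow> v \<in> e \<Longrightarrow> v \<in> e' \<Longrightarrow> e = e'"
  unfolding matching_def pairwise_def disjnt_def by blast

text \<open>This is Gallai's lemma. If \<open>N\<close> misses \<open>v\<close> and has the largest possible intersection with \<open>M\<close>,
  then the vertices missed by \<open>N\<close> but not by \<open>M\<close> cannot outnumber one: exchanging an edge of
  \<open>N\<close> for an edge of \<open>M\<close> at a second such vertex would enlarge the intersection.\<close>

lemma max_matching_misses_pair:
  assumes fin: "finite E" and two: "\<forall>e\<in>E. card e = 2"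
    and M: "max_matching E M" "u \<notin> \<Union>M" "w \<notin> \<Union>M" "u \<noteq> w"
    and N0: "max_matching E N0" "v \<notin> \<Union>N0"
  shows "\<exists>N. max_matching E N \<and> v \<notin> \<Union>N \<and> (u \<notin> \<Union>N \<or> w \<notin> \<Union>N)"
proof (rule ccontr)
  assume neg: "\<not> ?thesis"
  have "\<exists>N. (max_matching E N \<and> v \<notin> \<Union>N) \<and>
      (\<forall>N'. max_matching E N' \<and> v \<notin> \<Union>N' \<longrightarrow> card (M \<inter> N') \<le> card (M \<inter> N))"
  proof (rule ex_has_greatest_nat)
    show "max_matching E N0 \<and> v \<notin> \<Union>N0" using N0 by simp
    show "\<forall>N. max_matching E N \<and> v \<notin> \<Union>N \<longrightarrow> card (M \<inter> N) < Suc (card E)"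
      using fin by (auto simp: max_matching_def matching_def less_Suc_eq_le intro!: card_mono)
  qed
  then obtain N where N: "max_matching E N" "v \<notin> \<Union>N"
    and best: "\<And>N'. max_matching E N' \<Longrightarrow> v \<notin> \<Union>N' \<Longrightarrow> card (M \<inter> N') \<le> card (M \<inter> N)"
    by blast
  have mM: "matching E M" and mN: "matching E N" and same: "card M = card N"
    using M N by (auto simp: max_matching_def intro: le_antisym)
  have finM: "finite M" "finite N" "finite (\<Union>M)" "finite (\<Union>N)"
    using mM mN fin two
    by (auto simp: matching_def dest: finite_subset intro!: finite_Union)
      (metis card.infinite subsetD zero_neq_numeral)+
  have cM: "card (\<Union>M) = 2 * card M" and cN: "card (\<Union>N) = 2 * card N"
    using mM mN two by (auto simp: matching_def intro!: card_Union_matching)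
  \<comment> \<open>By the negated goal every maximum matching that misses \<open>v\<close> covers
    both \<open>u\<close> and \<open>w\<close>. Since \<open>M\<close> and \<open>N\<close> cover
    equally many vertices, at least two vertices are covered by \<open>M\<close> only, and one of
    them is not \<open>v\<close>.\<close>
  have uw: "{u, w} \<subseteq> \<Union>N - \<Union>M" using neg N M by auto
  have "2 \<le> card (\<Union>N - \<Union>M)"
    using card_mono[OF _ uw] finM \<open>u \<noteq> w\<close> by simp
  moreover have "card (\<Union>N - \<Union>M) = card (\<Union>M - \<Union>N)"
    using card_Diff_subset_Int[of "\<Union>N" "\<Union>M"] card_Diff_subset_Int[of "\<Union>M" "\<Union>N"]
      finM cM cN same by (simp add: Int_commute)
  ultimately have "\<not> \<Union>M - \<Union>N \<subseteq> {v}"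
    using card_mono[of "{v}" "\<Union>M - \<Union>N"] by auto
  then obtain x where x: "x \<in> \<Union>M" "x \<notin> \<Union>N" "x \<noteq> v" by blast
  then obtain e where e: "e \<in> M" "x \<in> e" by blast
  then have "e \<in> E" "card e = 2" using mM two by (auto simp: matching_def)
  then obtain y where y: "e = {x, y}" "x \<noteq> y"
    using \<open>x \<in> e\<close> by (auto simp: card_2_iff)
  have "y \<in> \<Union>N"
  proof (rule ccontr)
    assume "y \<notin> \<Union>N"
    then have "matching E (insert e N)"
      using mN \<open>e \<in> E\<close> x y by (intro matching_insert) auto
    moreover have "e \<notin> N" using x y by auto
    ultimately show False
      using N finM by (auto simp: max_matching_def)
  qed
  then obtain d where d: "d \<in> N" "y \<in> d" by blast
  then have "d \<notin> M" using matching_unique[OF mM e(1), of d y] y x by auto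
  have "e \<notin> N" using x y by auto
  \<comment> \<open>The exchange: \<open>?N\<close> is again maximum and still misses
    \<open>v\<close>, because \<open>x \<noteq> v\<close> and \<open>y\<close>, unlike
    \<open>v\<close>, is covered by \<open>N\<close>. It gains the edge \<open>e\<close> of
    \<open>M\<close> and loses only \<open>d\<close>, which is not in \<open>M\<close>.\<close>
  let ?N = "insert e (N - {d})"
  have "y \<notin> \<Union>(N - {d})" using matching_unique[OF mN d(1) _ d(2)] by blast
  then have "matching E ?N"
    using x y \<open>e \<in> E\<close> by (intro matching_insert matching_subset[OF mN]) auto
  moreover have "card ?N = card N"
    using finM \<open>e \<notin> N\<close> d card_gt_0_iff[of N] by (auto simp: card_Diff_singleton)
  ultimately have "max_matching E ?N" using N by (simp add: max_matching_def)
  moreover have "v \<notin> \<Union>?N" using x y \<open>y \<in> \<Union>N\<close> N by auto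
  ultimately have "card (M \<inter> ?N) \<le> card (M \<inter> N)" by (rule best)
  moreover have "M \<inter> ?N = insert e (M \<inter> N)" using \<open>d \<notin> M\<close> e by auto
  ultimately show False using finM \<open>e \<notin> N\<close> by simp
qed

text \<open>By Gallai's lemma, not being missed simultaneously by a maximum matching is an equivalence
  relation. Adjacent vertices are equivalent, and \<open>f\<close> below maps a vertex to its class.\<close>

lemma Tutte_Berge_all_missable:
  assumes fin: "finite V" and E: "\<forall>e\<in>E. e \<subseteq> V \<and> card e = 2"
    and miss: "\<forall>v\<in>V. \<exists>N. max_matching E N \<and> v \<notin> \<Union>N"
    and M: "max_matching E M"
  shows "\<exists>f :: 'a \<Rightarrow> 'a set. (\<forall>u v. {u, v} \<in> E \<longrightarrow> f u = f v) \<and>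
    (\<Sum>c\<in>f ` V. card {v\<in>V. f v = c} div 2) \<le> card M"
proof -
  have finE: "finite E"
    using fin E by (meson Pow_iff finite_Pow_iff finite_subset subsetI)
  have two: "\<forall>e\<in>E. card e = 2" using E by blast
  define bad where "bad u v \<longleftrightarrow> u \<noteq> v \<and> (\<exists>N. max_matching E N \<and> u \<notin> \<Union>N \<and> v \<notin> \<Union>N)" for u v
  define f where "f v = {u\<in>V. \<not> bad u v}" for v
  have sym: "bad u v \<longleftrightarrow> bad v u" for u v by (auto simp: bad_def)
  \<comment> \<open>Transitivity of the complement of \<open>bad\<close>, in contrapositive form.
    The assumption \<open>miss\<close> supplies the matching missing \<open>v\<close> that Gallai's
    lemma starts from.\<close>
  have trans: "bad u v \<or> bad v w" if "bad u w" "v \<in> V" for u v w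
  proof (cases "u = v \<or> v = w")
    case True then show ?thesis using that by auto
  next
    case False
    obtain M' where "max_matching E M'" "u \<notin> \<Union>M'" "w \<notin> \<Union>M'" "u \<noteq> w"
      using \<open>bad u w\<close> by (auto simp: bad_def)
    moreover obtain N0 where "max_matching E N0" "v \<notin> \<Union>N0" using miss \<open>v \<in> V\<close> by blast
    ultimately show ?thesis
      using max_matching_misses_pair[OF finE two, of M' u w N0 v] False
      unfolding bad_def by blast
  qed
  have f_eq: "f u = f v \<longleftrightarrow> \<not> bad u v" if "u \<in> V" "v \<in> V" for u v
  proof
    assume "f u = f v"
    moreover have "u \<in> f u" using that by (simp add: f_def bad_def)
    ultimately show "\<not> bad u v" by (simp add: f_def)
  next
    assume "\<not> bad u v"
    then show "f u = f v" using trans that sym unfolding f_def by blast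
  qed
  have edge: "f u = f v" if "{u, v} \<in> E" for u v
  proof -
    have "u \<in> V" "v \<in> V" "u \<noteq> v" using that E by fastforce+
    moreover have "\<not> bad u v"
    proof
      assume "bad u v"
      then obtain N where N: "max_matching E N" "u \<notin> \<Union>N" "v \<notin> \<Union>N" by (auto simp: bad_def)
      then have "matching E (insert {u, v} N)"
        using that by (intro matching_insert) (auto simp: max_matching_def)
      moreover have "finite N"
        using N finE by (auto simp: max_matching_def matching_def dest: finite_subset)
      moreover have "{u, v} \<notin> N" using N by blast
      moreover have "card (insert {u, v} N) \<le> card N"
        using N \<open>matching E (insert {u, v} N)\<close> by (simp add: max_matching_def)
      ultimately show False by simp
    qed
    ultimately show ?thesis using f_eq by simp
  qed
  have mM: "matching E M" using M by (simp add: max_matching_def)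
  then have finM: "finite M" using finE by (auto simp: matching_def dest: finite_subset)
  define K where "K c = {v\<in>V. f v = c}" for c
  define MK where "MK c = {e\<in>M. e \<subseteq> K c}" for c
  \<comment> \<open>\<open>M\<close> misses at most one vertex of a class, since two missed vertices
    would be \<open>bad\<close>; and an edge of \<open>M\<close> meeting the class lies inside it.
    Rounding down absorbs the possible missed vertex.\<close>
  have half: "card (K c) div 2 \<le> card (MK c)" for c
  proof -
    have "pairwise disjnt (MK c)" "\<forall>e\<in>MK c. card e = 2"
      using mM two unfolding matching_def MK_def pairwise_def by blast+
    then have cU: "card (\<Union>(MK c)) = 2 * card (MK c)" by (rule card_Union_matching)
    have "\<exists>e\<in>M. v \<in> e \<and> e \<subseteq> K c" if v: "v \<in> K c" "v \<in> \<Union>M" for v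
    proof -
      obtain e where e: "e \<in> M" "v \<in> e" using v by blast
      then have "e \<in> E" using mM by (auto simp: matching_def)
      then obtain a b where "e = {a, b}" using two by (meson card_2_iff)
      then have "e = {v, a} \<or> e = {v, b}" using e by auto
      then obtain u where u: "e = {v, u}" by blast
      then have "f v = f u" "e \<subseteq> V" using edge E \<open>e \<in> E\<close> by blast+
      then have "e \<subseteq> K c" using v u by (auto simp: K_def)
      then show ?thesis using e by blast
    qed
    then have unc: "K c - \<Union>(MK c) \<subseteq> V - \<Union>M" by (auto simp: MK_def K_def)
    have single: "x = y" if xy: "x \<in> K c - \<Union>(MK c)" "y \<in> K c - \<Union>(MK c)" for x y
    proof (rule ccontr)
      assume "x \<noteq> y"
      then have "bad x y" using xy unc M unfolding bad_def by blast
      moreover have "x \<in> V" "y \<in> V" "f x = f y" using xy by (auto simp: K_def)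
      ultimately show False using f_eq by blast
    qed
    have "finite (K c)" using fin by (simp add: K_def)
    then have "card (K c - \<Union>(MK c)) \<le> 1"
      using single by (simp add: card_le_Suc0_iff_eq)
    moreover have "\<Union>(MK c) \<subseteq> K c" by (auto simp: MK_def)
    ultimately have "card (K c) \<le> 2 * card (MK c) + 1"
      using cU \<open>finite (K c)\<close> by (simp add: card_Diff_subset finite_subset)
    then show ?thesis by linarith
  qed
  have "(\<Sum>c\<in>f ` V. card (K c) div 2) \<le> (\<Sum>c\<in>f ` V. card (MK c))"
    by (intro sum_mono half)
  also have "\<dots> = card (\<Union>c\<in>f ` V. MK c)"
  proof (rule card_UN_disjoint[symmetric])
    \<comment> \<open>Only an empty edge could be contained in two different classes.\<close>
    have "e \<noteq> {}" if "e \<in> M" for e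
      using that mM two unfolding matching_def by (metis card.empty subsetD zero_neq_numeral)
    moreover have "e = {}" if "e \<in> MK i" "e \<in> MK j" "i \<noteq> j" for e i j
      using that by (auto simp: MK_def K_def)
    ultimately have "MK i \<inter> MK j = {}" if "i \<noteq> j" for i j
      using that unfolding MK_def by blast
    then show "\<forall>i\<in>f ` V. \<forall>j\<in>f ` V. i \<noteq> j \<longrightarrow> MK i \<inter> MK j = {}" by blast
  qed (use fin finM in \<open>auto simp: MK_def\<close>)
  also have "\<dots> \<le> card M"
    using finM by (intro card_mono) (auto simp: MK_def)
  finally have "(\<Sum>c\<in>f ` V. card {v\<in>V. f v = c} div 2) \<le> card M" unfolding K_def .
  then show ?thesis using edge by (intro exI[of _ f]) simp
qed

text \<open>The labelling \<open>f\<close> plays the role of the components of the graph minus \<open>U\<close>: its classes are unions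
  of components, which is all that is needed.\<close>

theorem Tutte_Berge:
  assumes "finite V" "\<forall>e\<in>E. e \<subseteq> V \<and> card e = 2"
  shows "\<exists>M U (f :: 'a \<Rightarrow> 'a set). matching E M \<and> U \<subseteq> V \<and>
    (\<forall>u v. {u, v} \<in> E \<and> u \<notin> U \<and> v \<notin> U \<longrightarrow> f u = f v) \<and>
    card U + (\<Sum>c\<in>f ` (V - U). card {v\<in>V - U. f v = c} div 2) \<le> card M"
  using assms
proof (induction "card V" arbitrary: V E rule: less_induct)
  case less
  have finE: "finite E"
    using less.prems by (meson Pow_iff finite_Pow_iff finite_subset subsetI)
  then obtain M where M: "max_matching E M" using ex_max_matching by blast
  show ?case
  proof (cases "\<forall>v\<in>V. \<exists>N. max_matching E N \<and> v \<notin> \<Union>N")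
    case True
    obtain f :: "'a \<Rightarrow> 'a set" where "\<forall>u v. {u, v} \<in> E \<longrightarrow> f u = f v"
        "(\<Sum>c\<in>f ` V. card {v\<in>V. f v = c} div 2) \<le> card M"
      using Tutte_Berge_all_missable[OF less.prems True M] by blast
    then show ?thesis
      using M by (intro exI[of _ M] exI[of _ "{}"] exI[of _ f]) (auto simp: max_matching_def)
  next
    case False
    then obtain v where v: "v \<in> V" and cov: "\<And>N. max_matching E N \<Longrightarrow> v \<in> \<Union>N" by blast
    let ?E = "{e\<in>E. v \<notin> e}"
    \<comment> \<open>Delete \<open>v\<close> and add it to the set \<open>U\<close> of the smaller
      graph. The matching \<open>M'\<close> found there misses \<open>v\<close>, so it is not
      maximum in \<open>E\<close>; the additional edge of \<open>M\<close> pays for the additional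
      element of \<open>U\<close>.\<close>
    have "card (V - {v}) < card V" using v less.prems(1) by (intro card_Diff1_less)
    moreover have "finite (V - {v})" using less.prems by simp
    moreover have "\<forall>e\<in>?E. e \<subseteq> V - {v} \<and> card e = 2" using less.prems by blast
    ultimately have "\<exists>M' U (f :: 'a \<Rightarrow> 'a set). matching ?E M' \<and> U \<subseteq> V - {v} \<and>
      (\<forall>u w. {u, w} \<in> ?E \<and> u \<notin> U \<and> w \<notin> U \<longrightarrow> f u = f w) \<and>
      card U + (\<Sum>c\<in>f ` (V - {v} - U). card {u\<in>V - {v} - U. f u = c} div 2) \<le> card M'"
      by (rule less.hyps)
    then obtain M' U and f :: "'a \<Rightarrow> 'a set" where
      M': "matching ?E M'" and U: "U \<subseteq> V - {v}"
      and f: "\<forall>u w. {u, w} \<in> ?E \<and> u \<notin> U \<and> w \<notin> U \<longrightarrow> f u = f w"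
      and le: "card U + (\<Sum>c\<in>f ` (V - {v} - U). card {u\<in>V - {v} - U. f u = c} div 2) \<le> card M'"
      by blast
    have "v \<notin> \<Union>M'" using M' by (auto simp: matching_def)
    moreover have "matching E M'" using M' by (auto simp: matching_def)
    ultimately have "card M' < card M"
      using cov[of M'] M unfolding max_matching_def by (meson le_trans not_le)
    moreover have "V - {v} - U = V - insert v U" by auto
    moreover have "card (insert v U) = Suc (card U)"
      using U less.prems(1) by (subst card_insert_disjoint) (auto dest: finite_subset)
    ultimately have "card (insert v U) +
        (\<Sum>c\<in>f ` (V - insert v U). card {u\<in>V - insert v U. f u = c} div 2) \<le> card M"
      using le by simp
    moreover have "\<forall>u w. {u, w} \<in> E \<and> u \<notin> insert v U \<and> w \<notin> insert v U \<longrightarrow> f u = f w"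
      using f by blast
    moreover have "matching E M" "insert v U \<subseteq> V" using M U v by (auto simp: max_matching_def)
    ultimately show ?thesis by blast
  qed
qed

section \<open>Halved class sizes under refinement of a partition\<close>

lemma sum_div2_le: "finite A \<Longrightarrow> (\<Sum>x\<in>A. g x div 2) \<le> (\<Sum>x\<in>A. g x :: nat) div 2"
  by (induction A rule: finite_induct) auto

text \<open>Every class of \<open>f\<close> is a disjoint union of classes of \<open>h\<close>, and
  halving with rounding down is superadditive. This later lets the Tutte-Berge labels be replaced by
  the components of \<open>graph_ST\<close>.\<close>

lemma sum_div2_refine:
  assumes "finite A" and ref: "\<And>x y. x \<in> A \<Longrightarrow> y \<in> A \<Longrightarrow> h x = h y \<Longrightarrow> f x = f y"
  shows "(\<Sum>c\<in>h ` A. card {x\<in>A. h x = c} div 2) \<le> (\<Sum>c\<in>f ` A. card {x\<in>A. f x = c} div 2)"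
proof -
  let ?H = "\<lambda>d. h ` {x\<in>A. f x = d}"
  have part: "h ` A = (\<Union>d\<in>f ` A. ?H d)" by auto
  have "(\<Sum>c\<in>h ` A. card {x\<in>A. h x = c} div 2) =
      (\<Sum>d\<in>f ` A. \<Sum>c\<in>?H d. card {x\<in>A. h x = c} div 2)"
    unfolding part
  proof (rule sum.UNION_disjoint)
    show "\<forall>d\<in>f ` A. \<forall>d'\<in>f ` A. d \<noteq> d' \<longrightarrow> ?H d \<inter> ?H d' = {}"
      using ref by blast
  qed (use \<open>finite A\<close> in simp_all)
  also have "\<dots> \<le> (\<Sum>d\<in>f ` A. card {x\<in>A. f x = d} div 2)"
  proof (rule sum_mono)
    fix d
    have "(\<Sum>c\<in>?H d. card {x\<in>A. h x = c} div 2) \<le> (\<Sum>c\<in>?H d. card {x\<in>A. h x = c}) div 2"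
      using \<open>finite A\<close> by (intro sum_div2_le) simp
    also have "(\<Sum>c\<in>?H d. card {x\<in>A. h x = c}) = card (\<Union>c\<in>?H d. {x\<in>A. h x = c})"
      using \<open>finite A\<close> by (intro card_UN_disjoint[symmetric]) auto
    also have "(\<Union>c\<in>?H d. {x\<in>A. h x = c}) = {x\<in>A. f x = d}"
      by (auto dest: ref)
    finally show "(\<Sum>c\<in>?H d. card {x\<in>A. h x = c} div 2) \<le> card {x\<in>A. f x = d} div 2" .
  qed
  finally show ?thesis .
qed

section \<open>From matchings to disjoint paths\<close>

lemma is_path_Nil: "is_path G (vs, []) \<longleftrightarrow> (\<exists>v\<in>verts G. vs = [v])"
  by (auto simp: is_path_def length_Suc_conv)

lemma is_path_Cons:
  "is_path G (v # vs, e # es) \<longleftrightarrow> v \<in> verts G \<and> v \<notin> set vs \<and> e \<in> edges G \<and> vs \<noteq> [] \<and>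
     ends G e = {v, hd vs} \<and> is_path G (vs, es)"
  by (cases vs) (auto simp: is_path_def All_less_Suc2)

lemma is_bipath_Cons:
  "is_bipath G \<sigma> (v # vs, e # es) \<longleftrightarrow> v \<in> verts G \<and> v \<notin> set vs \<and> e \<in> edges G \<and> vs \<noteq> [] \<and>
     ends G e = {v, hd vs} \<and> (es \<noteq> [] \<longrightarrow> \<sigma> (hd vs) e \<noteq> \<sigma> (hd vs) (hd es)) \<and>
     is_bipath G \<sigma> (vs, es)"
proof -
  have "(\<forall>i. Suc i < length (e # es) \<longrightarrow> P i) \<longleftrightarrow>
      (es \<noteq> [] \<longrightarrow> P 0) \<and> (\<forall>i. Suc i < length es \<longrightarrow> P (Suc i))" for P
    by (cases es) (auto simp: All_less_Suc2)
  then show ?thesis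
    unfolding is_bipath_def prod.case is_path_Cons
    by (cases vs; cases es) (simp_all add: conj_ac)
qed

lemma is_bipath_rev:
  assumes "is_bipath G \<sigma> (vs, es)"
  shows "is_bipath G \<sigma> (rev vs, rev es)"
proof -
  let ?n = "length es"
  have len: "length vs = Suc ?n" using assms by (simp add: is_bipath_def is_path_def)
  have "ends G (rev es ! i) = {rev vs ! i, rev vs ! Suc i}" if "i < ?n" for i
  proof -
    have "ends G (es ! (?n - Suc i)) = {vs ! (?n - Suc i), vs ! Suc (?n - Suc i)}"
      using assms that by (simp add: is_bipath_def is_path_def)
    then show ?thesis using that len by (auto simp: rev_nth Suc_diff_Suc)
  qed
  moreover have "\<sigma> (rev vs ! Suc i) (rev es ! i) \<noteq> \<sigma> (rev vs ! Suc i) (rev es ! Suc i)"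
    if "Suc i < ?n" for i
  proof -
    let ?j = "?n - Suc (Suc i)"
    have "\<sigma> (vs ! Suc ?j) (es ! ?j) \<noteq> \<sigma> (vs ! Suc ?j) (es ! Suc ?j)"
      using assms that by (simp add: is_bipath_def)
    moreover have "Suc ?j = ?n - Suc i" using that by simp
    ultimately show ?thesis using that len by (auto simp: rev_nth)
  qed
  ultimately show ?thesis using assms by (simp add: is_bipath_def is_path_def)
qed

text \<open>A link is a path through \<open>Z\<close> whose ends leave through open ports. A port \<open>(v, s) \<in> Q\<close> stands for a
  vertex \<open>v\<close> at which only half-edges of sign \<open>s\<close> may be used. The induction below cuts the first edge
  off an augmenting path; this turns the next vertex of \<open>Z\<close> into an open port of the other sign.\<close>

definition link ::
  "('v, 'e) multigraph \<Rightarrow> ('v, 'e) signing \<Rightarrow> 'v set \<Rightarrow> ('v \<times> sign) set \<Rightarrow> ('v, 'e) mpath \<Rightarrow> bool" where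
  "link G \<sigma> Z Q = (\<lambda>(vs, es). is_bipath G \<sigma> (vs, es) \<and> es \<noteq> [] \<and>
     (hd vs, \<sigma> (hd vs) (hd es)) \<in> Q \<and> (last vs, \<sigma> (last vs) (last es)) \<in> Q \<and>
     set (butlast (tl vs)) \<subseteq> Z)"

lemma link_rev:
  assumes "link G \<sigma> Z Q (vs, es)"
  shows "link G \<sigma> Z Q (rev vs, rev es)"
proof -
  have "butlast (tl (rev vs)) = rev (butlast (tl vs))"
    by (metis butlast_rev butlast_tl rev_swap)
  then show ?thesis
    using assms by (simp add: link_def is_bipath_rev hd_rev last_rev)
qed

lemma set_ends_inner:
  assumes "vs \<noteq> []"
  shows "set vs = {hd vs, last vs} \<union> set (butlast (tl vs))"
proof (cases "tl vs = []")
  case True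
  then show ?thesis using assms by (cases vs) auto
next
  case False
  then have "vs = hd vs # butlast (tl vs) @ [last vs]"
    using assms by (metis append_butlast_last_id last_tl list.collapse)
  then have "set vs = set (hd vs # butlast (tl vs) @ [last vs])" by (rule arg_cong)
  then show ?thesis by auto
qed

lemma link_nonempty: "link G \<sigma> Z Q (vs, es) \<Longrightarrow> vs \<noteq> []"
  by (auto simp: link_def is_bipath_def is_path_def)

lemma link_subset:
  assumes "link G \<sigma> Z Q (vs, es)"
  shows "set vs \<subseteq> fst ` Q \<union> Z"
proof -
  have "hd vs \<in> fst ` Q" "last vs \<in> fst ` Q" "set (butlast (tl vs)) \<subseteq> Z"
    using assms by (auto simp: link_def intro: rev_image_eqI)
  then show ?thesis by (subst set_ends_inner[OF link_nonempty[OF assms]]) auto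
qed

text \<open>Open ports matter only at vertices of the link itself, so \<open>Q'\<close> may lack
  ports of \<open>Q\<close> elsewhere.\<close>

lemma link_mono:
  assumes "link G \<sigma> Z Q (vs, es)" "Z \<subseteq> Z'"
    and Q: "\<And>q. q \<in> Q \<Longrightarrow> fst q \<in> set vs \<Longrightarrow> q \<in> Q'"
  shows "link G \<sigma> Z' Q' (vs, es)"
proof -
  have "hd vs \<in> set vs" "last vs \<in> set vs" using link_nonempty[OF assms(1)] by simp_all
  then show ?thesis using assms(1,2) Q unfolding link_def prod.case by (metis fst_conv subset_trans)
qed

definition linked :: "('v, 'e) multigraph \<Rightarrow> ('v, 'e) signing \<Rightarrow> 'v set \<Rightarrow> ('v \<times> sign) set \<Rightarrow> nat \<Rightarrow> bool" where
  "linked G \<sigma> Z Q k \<longleftrightarrow>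
     (\<exists>\<P>. finite \<P> \<and> card \<P> = k \<and> (\<forall>P\<in>\<P>. link G \<sigma> Z Q P) \<and> disjoint_paths \<P>)"

lemma linked_insert:
  assumes "finite \<P>" "\<forall>P\<in>\<P>. link G \<sigma> Z Q P" "disjoint_paths \<P>"
    and P: "link G \<sigma> Z Q P" "\<forall>P'\<in>\<P>. set (fst P) \<inter> set (fst P') = {}"
  shows "linked G \<sigma> Z Q (Suc (card \<P>))"
proof -
  \<comment> \<open>Being nonempty, \<open>P\<close> is not disjoint from itself, so its
    disjointness from all members of the family makes it a new member.\<close>
  have "set (fst P) \<noteq> {}"
    using link_nonempty[of G \<sigma> Z Q "fst P" "snd P"] P(1) by simp
  then have "P \<notin> \<P>" using P(2) by auto
  have "disjoint_paths (insert P \<P>)"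
    using assms(3) P(2) unfolding disjoint_paths_def pairwise_insert disjnt_def
    by (simp add: Int_commute)
  moreover have "card (insert P \<P>) = Suc (card \<P>)"
    using \<open>P \<notin> \<P>\<close> assms(1) by simp
  moreover have "\<forall>P'\<in>insert P \<P>. link G \<sigma> Z Q P'" using assms(2) P(1) by simp
  ultimately show ?thesis
    using assms(1) unfolding linked_def by (intro exI[of _ "insert P \<P>"]) simp
qed

text \<open>The inner vertices of a link lie in \<open>Z\<close>, so \<open>w\<close> is one of the
  two ends; if it is the last vertex, reverse the link.\<close>

lemma link_starting_at_end:
  assumes P: "link G \<sigma> Z Q (vs, es)" and w: "w \<in> set vs" "w \<notin> Z"
  obtains vs' es' where "link G \<sigma> Z Q (w # vs', es')" "set (w # vs') = set vs"
proof -
  have ne: "vs \<noteq> []" using link_nonempty[OF P] .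
  then consider "w = hd vs" | "w = last vs"
    using set_ends_inner[OF ne] w P by (auto simp: link_def)
  then show thesis
  proof cases
    case 1
    then show thesis using that[of "tl vs" es] P ne by simp
  next
    case 2
    then have "w # tl (rev vs) = rev vs" using ne by (simp add: hd_rev[symmetric])
    then show thesis using that[of "tl (rev vs)" "rev es"] link_rev[OF P] by (metis set_rev)
  qed
qed

text \<open>The only port of \<open>Q'\<close> at \<open>w\<close> is \<open>(w, c)\<close>, so the
  given link leaves \<open>w\<close> with sign \<open>c\<close>. The edge \<open>e\<close> arrives
  there with the other sign, which makes \<open>w\<close> an admissible inner vertex. The far end
  differs from \<open>w\<close>, hence its port already belongs to \<open>Q\<close>.\<close>

lemma link_Cons:
  assumes P: "link G \<sigma> Z' Q' (w # vs, es)"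
    and Z: "Z' \<subseteq> Z" "w \<in> Z" and Q: "Q' \<subseteq> insert (w, c) Q" "w \<notin> fst ` Q"
    and v: "v \<in> verts G" "v \<notin> set (w # vs)" "(v, \<sigma> v e) \<in> Q"
    and e: "e \<in> edges G" "ends G e = {v, w}" "\<sigma> w e \<noteq> c"
  shows "link G \<sigma> Z Q (v # w # vs, e # es)"
proof -
  have bp: "is_bipath G \<sigma> (w # vs, es)" and ne: "es \<noteq> []" and inner: "set (butlast vs) \<subseteq> Z'"
    and hd: "(w, \<sigma> w (hd es)) \<in> Q'"
    and last: "(last (w # vs), \<sigma> (last (w # vs)) (last es)) \<in> Q'"
    using P by (auto simp: link_def)
  obtain d es' where es: "es = d # es'" using ne by (cases es) auto
  have vs: "vs \<noteq> []" "w \<notin> set vs" using bp by (auto simp: es is_bipath_Cons)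
  then have "last vs \<noteq> w" by (metis last_in_set)
  then have "(last vs, \<sigma> (last vs) (last es)) \<in> Q" using last Q vs by auto
  moreover have "\<sigma> w (hd es) = c" using hd Q by (force intro: rev_image_eqI)
  ultimately show ?thesis
    using vs v e bp inner Z ne by (auto simp: link_def is_bipath_Cons)
qed

text \<open>This puts back a first edge that was cut off. By disjointness at most one link visits
  \<open>w\<close>; it must end there and is prolonged along \<open>e\<close> to \<open>v\<close>,
  which no link visits. All other links stay as they are, so their number is unchanged.\<close>

lemma linked_extend:
  assumes linked: "linked G \<sigma> Z' Q' k"
    and Z: "Z' \<subseteq> Z" "w \<in> Z" "w \<notin> Z'" and Q: "Q' \<subseteq> insert (w, c) Q" "w \<notin> fst ` Q"
    and v: "v \<in> verts G" "v \<notin> Z'" "v \<notin> fst ` Q'" "(v, \<sigma> v e) \<in> Q"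
    and e: "e \<in> edges G" "ends G e = {v, w}" "\<sigma> w e \<noteq> c"
  shows "linked G \<sigma> Z Q k"
proof -
  obtain \<P> where \<P>: "finite \<P>" "card \<P> = k" "\<forall>P\<in>\<P>. link G \<sigma> Z' Q' P" "disjoint_paths \<P>"
    using linked by (auto simp: linked_def)
  have keep: "link G \<sigma> Z Q P" if "P \<in> \<P>" "w \<notin> set (fst P)" for P
  proof -
    obtain vs es where [simp]: "P = (vs, es)" by (cases P)
    have "link G \<sigma> Z' Q' (vs, es)" using \<P> that by auto
    then have "link G \<sigma> Z Q (vs, es)" using Z(1) by (rule link_mono) (use that Q in auto)
    then show ?thesis by simp
  qed
  have avoid: "v \<notin> set (fst P)" if "P \<in> \<P>" for P
    using link_subset[of G \<sigma> Z' Q' "fst P" "snd P"] \<P> v that by auto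
  show ?thesis
  proof (cases "\<exists>P\<in>\<P>. w \<in> set (fst P)")
    case False
    then show ?thesis using \<P> keep by (auto simp: linked_def)
  next
    case True
    then obtain P where P: "P \<in> \<P>" "w \<in> set (fst P)" by blast
    have dis: "set (fst P) \<inter> set (fst P') = {}" if "P' \<in> \<P> - {P}" for P'
      using \<P>(4) P that by (auto simp: disjoint_paths_def pairwise_def disjnt_def)
    have "link G \<sigma> Z' Q' (fst P, snd P)" using \<P> P by simp
    then obtain vs es where vs: "link G \<sigma> Z' Q' (w # vs, es)" "set (w # vs) = set (fst P)"
      using link_starting_at_end P Z by metis
    have "link G \<sigma> Z Q (v # w # vs, e # es)"
      using avoid[OF P(1)] vs by (intro link_Cons[OF vs(1) Z(1,2) Q v(1) _ v(4) e]) simp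
    moreover have "set (v # w # vs) \<inter> set (fst P') = {}" if "P' \<in> \<P> - {P}" for P'
      using avoid[of P'] dis[OF that] vs(2) that by auto
    moreover have "\<forall>P'\<in>\<P> - {P}. link G \<sigma> Z Q P'" using keep dis P(2) by (meson DiffD1 disjoint_iff)
    moreover have "disjoint_paths (\<P> - {P})"
      using \<P>(4) unfolding disjoint_paths_def by (rule pairwise_mono) auto
    ultimately have "linked G \<sigma> Z Q (Suc (card (\<P> - {P})))"
      using \<P>(1) by (intro linked_insert[where P = "(v # w # vs, e # es)"]) auto
    then show ?thesis using \<P> P by (metis card_Suc_Diff1)
  qed
qed

section \<open>Reading links off a matching of ports\<close>

lemma UNIV_sign: "(UNIV :: sign set) = {Plus, Minus}"
  using sign.exhaust by auto

definition port_edge :: "('v, 'e) multigraph \<Rightarrow> ('v, 'e) signing \<Rightarrow> ('v \<times> sign) \<Rightarrow> ('v \<times> sign) \<Rightarrow> 'e \<Rightarrow> bool" where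
  "port_edge G \<sigma> p q e \<longleftrightarrow> e \<in> edges G \<and> ends G e = {fst p, fst q} \<and>
     \<sigma> (fst p) e = snd p \<and> \<sigma> (fst q) e = snd q"

text \<open>Augmenting paths are traced edge by edge, without forming a symmetric difference. Take a
  matching edge at an open port \<open>p\<close>. If its other end \<open>q\<close> is open too, the
  edge is a link by itself, and \<open>k\<close> drops together with \<open>card M\<close>.
  Otherwise \<open>q\<close> belongs to a vertex of \<open>Z\<close>; that vertex leaves
  \<open>Z\<close> and its other port becomes open, so \<open>card Z\<close> drops together with
  \<open>card M\<close>. Either way \<open>card Z + k \<le> card M\<close> survives.\<close>

lemma linked_of_matching:
  assumes "finite Z" "finite Q" "inj_on fst Q" "fst ` Q \<inter> Z = {}" "fst ` Q \<union> Z \<subseteq> verts G"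
    and "pairwise disjnt M" "\<forall>m\<in>M. card m = 2" "\<Union>M \<subseteq> Q \<union> Z \<times> UNIV"
    and "\<And>p q. {p, q} \<in> M \<Longrightarrow> fst p \<noteq> fst q \<Longrightarrow> \<exists>e. port_edge G \<sigma> p q e"
    and "card Z + k \<le> card M"
  shows "linked G \<sigma> Z Q k"
  using assms
proof (induction "card M" arbitrary: M Z Q k)
  case 0
  then show ?case by (auto simp: linked_def disjoint_paths_def intro!: exI[of _ "{}"])
next
  case (Suc n)
  note prems = Suc.prems
  have finM: "finite M" using Suc.hyps(2) by (metis card.infinite nat.distinct(1))
  show ?case
  proof (cases "\<exists>p\<in>Q. p \<in> \<Union>M")
    case False
    \<comment> \<open>With no open port covered, \<open>M\<close> matches only the
      \<open>2 * card Z\<close> ports of \<open>Z\<close>; so \<open>card M \<le> card Z\<close> and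
      no link is demanded.\<close>
    have "finite (Z \<times> (UNIV :: sign set))" using prems(1) by (simp add: UNIV_sign)
    moreover have "\<Union>M \<subseteq> Z \<times> UNIV" using False prems(8) by blast
    ultimately have "card (\<Union>M) \<le> card (Z \<times> (UNIV :: sign set))" by (rule card_mono)
    also have "\<dots> = 2 * card Z" by (simp add: UNIV_sign card_cartesian_product)
    finally have "card M \<le> card Z" using card_Union_matching[OF prems(6,7)] by simp
    then have "k = 0" using prems by simp
    then show ?thesis by (auto simp: linked_def disjoint_paths_def intro!: exI[of _ "{}"])
  next
    case True
    then obtain p m where p: "p \<in> Q" "m \<in> M" "p \<in> m" by (elim bexE UnionE)
    obtain a b where "m = {a, b}" "a \<noteq> b" using prems(7) p(2) by (meson card_2_iff)
    then have "m = {p, if p = a then b else a}" "p \<noteq> (if p = a then b else a)" using p(3) by auto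
    then obtain q where q: "m = {p, q}" "p \<noteq> q" by metis
    let ?M = "M - {m}"
    have M: "n = card ?M" "pairwise disjnt ?M" "\<forall>m'\<in>?M. card m' = 2"
      using Suc.hyps(2) p finM prems by (auto intro: pairwise_mono)
    have M_ports: "\<exists>e. port_edge G \<sigma> p' q' e" if "{p', q'} \<in> ?M" "fst p' \<noteq> fst q'" for p' q'
      using prems(9) that by blast
    have M_sub: "\<Union>?M \<subseteq> Q \<union> Z \<times> UNIV - {p, q}"
    proof -
      have "m' \<inter> m = {}" if "m' \<in> ?M" for m'
        using pairwiseD[OF prems(6), of m' m] p(2) that by (simp add: disjnt_def)
      then have "\<Union>?M \<inter> {p, q} = {}" using q(1) by blast
      moreover have "\<Union>?M \<subseteq> \<Union>M" by blast
      ultimately show ?thesis using prems(8) by blast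
    qed
    \<comment> \<open>An open port is the only port of its vertex, so the matching edge at
      \<open>p\<close> is not of the form \<open>(v, Plus)(v, Minus)\<close> and comes from an edge
      of the graph.\<close>
    have "q \<in> Q \<or> fst q \<in> Z" using prems(8) p q by auto
    moreover have pZ: "fst p \<notin> Z" using prems(4) p by blast
    ultimately have "fst p \<noteq> fst q"
      using prems(3) p q by (auto dest: inj_onD)
    then obtain e where e: "port_edge G \<sigma> p q e" using prems(9) p q by blast
    have vp: "fst p \<in> verts G" using prems(5) p by blast
    show ?thesis
    proof (cases "q \<in> Q")
      case True
      show ?thesis
      proof (cases k)
        case 0
        then show ?thesis by (auto simp: linked_def disjoint_paths_def intro!: exI[of _ "{}"])
      next
        case (Suc k')
        let ?Q = "Q - {p, q}"
        have "linked G \<sigma> Z ?Q k'"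
        proof (rule Suc.hyps(1)[OF M(1)])
          show "inj_on fst ?Q" using prems(3) by (rule inj_on_subset) blast
          show "card Z + k' \<le> card ?M" using prems(10) Suc Suc.hyps(2) M(1) by simp
          have "fst p \<notin> Z" "fst q \<notin> Z" using prems(4) p True by blast+
          then show "\<Union>?M \<subseteq> ?Q \<union> Z \<times> UNIV" using M_sub by auto
        qed (use prems M M_ports in auto)
        then obtain \<P> where \<P>: "finite \<P>" "card \<P> = k'" "\<forall>P\<in>\<P>. link G \<sigma> Z ?Q P" "disjoint_paths \<P>"
          by (auto simp: linked_def)
        have vq: "fst q \<in> verts G" using prems(5) True by blast
        have qZ: "fst q \<notin> Z" using prems(4) True by blast
        have "fst p \<notin> fst ` ?Q" "fst q \<notin> fst ` ?Q"
          using prems(3) p True by (auto dest: inj_onD)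
        then have "\<forall>P'\<in>\<P>. {fst p, fst q} \<inter> set (fst P') = {}"
          using link_subset[of G \<sigma> Z ?Q] \<P>(3) pZ qZ by fastforce
        moreover have "link G \<sigma> Z Q ([fst p, fst q], [e])"
          using e p True vp vq \<open>fst p \<noteq> fst q\<close>
          by (simp add: link_def is_bipath_def is_path_def port_edge_def)
        moreover have "\<forall>P\<in>\<P>. link G \<sigma> Z Q P"
          using \<P>(3) by (auto intro: link_mono)
        ultimately show ?thesis
          using linked_insert[OF \<P>(1) _ \<P>(4), of G \<sigma> Z Q "([fst p, fst q], [e])"] \<P>(2) Suc
          by simp
      qed
    next
      case False
      then have w: "fst q \<in> Z" using prems(8) p q by auto
      \<comment> \<open>The other sign at \<open>fst q\<close>: with \<open>q\<close> used up,
        \<open>(fst q, c)\<close> is the only port of this vertex that the rest of the matching can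
        cover.\<close>
      define c where "c = (if snd q = Plus then Minus else Plus)"
      have c: "c \<noteq> snd q" by (auto simp: c_def)
      have c': "a = c \<or> a = snd q" for a by (cases a) (auto simp: c_def, (cases "snd q"; simp)+)
      let ?Z = "Z - {fst q}" and ?Q = "insert (fst q, c) (Q - {p})"
      have wQ: "fst q \<notin> fst ` Q" using prems(4) w by blast
      have "linked G \<sigma> ?Z ?Q k"
      proof (rule Suc.hyps(1)[OF M(1)])
        show "inj_on fst ?Q" using prems(3) wQ by (auto simp: inj_on_insert intro: inj_on_subset)
        show "fst ` ?Q \<inter> ?Z = {}" using prems(4) by auto
        show "fst ` ?Q \<union> ?Z \<subseteq> verts G" using prems(5) w by auto
        show "\<Union>?M \<subseteq> ?Q \<union> ?Z \<times> UNIV"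
        proof
          fix x assume "x \<in> \<Union>?M"
          then have x: "x \<in> Q \<union> Z \<times> UNIV" "x \<noteq> p" "x \<noteq> q" using M_sub by auto
          show "x \<in> ?Q \<union> ?Z \<times> UNIV"
          proof (cases "fst x = fst q")
            case True
            then have "snd x \<noteq> snd q" using x by (auto simp: prod_eq_iff)
            then have "x = (fst q, c)" using True c'[of "snd x"] by (simp add: prod_eq_iff)
            then show ?thesis by simp
          qed (use x in auto)
        qed
        show "card ?Z + k \<le> card ?M"
          using prems(1,10) w Suc.hyps(2) M(1) card_Suc_Diff1[of Z "fst q"] by simp
      qed (use prems M M_ports in auto)
      moreover have "fst p \<notin> fst ` ?Q"
        using prems(3) p \<open>fst p \<noteq> fst q\<close> by (auto dest: inj_onD)
      ultimately show ?thesis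
        using e p vp pZ c w wQ
        by (intro linked_extend[of G \<sigma> ?Z ?Q k Z "fst q" c Q "fst p" e]) (auto simp: port_edge_def)
    qed
  qed
qed

section \<open>Connected components\<close>

definition adj :: "('v, 'e) multigraph \<Rightarrow> ('v \<times> 'v) set" where
  "adj G = {(u, v). \<exists>e\<in>edges G. ends G e = {u, v}}"

definition reach :: "('v, 'e) multigraph \<Rightarrow> 'v \<Rightarrow> 'v set" where
  "reach G v = (adj G)\<^sup>* `` {v}"

definition comp_of :: "('v, 'e) multigraph \<Rightarrow> 'v \<Rightarrow> ('v, 'e) multigraph" where
  "comp_of G v = \<lparr>verts = reach G v, edges = {e\<in>edges G. ends G e \<subseteq> reach G v}, ends = ends G\<rparr>"

lemma adj_sym: "(u, v) \<in> (adj G)\<^sup>* \<longleftrightarrow> (v, u) \<in> (adj G)\<^sup>*"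
proof -
  have "sym (adj G)" by (auto simp: sym_def adj_def insert_commute)
  then show ?thesis by (meson sym_rtrancl symE)
qed

lemma reach_self: "v \<in> reach G v"
  by (simp add: reach_def)

lemma reach_eq_iff: "reach G u = reach G v \<longleftrightarrow> (u, v) \<in> (adj G)\<^sup>*"
  unfolding reach_def using adj_sym[of _ _ G] by (auto intro: rtrancl_trans)

lemma reach_eqI: "u \<in> reach G v \<Longrightarrow> reach G u = reach G v"
  unfolding reach_eq_iff adj_sym[of u] by (simp add: reach_def)

lemma reach_subset_verts:
  assumes "finite_multigraph G" "v \<in> verts G"
  shows "reach G v \<subseteq> verts G"
proof
  fix u assume "u \<in> reach G v"
  then have "(v, u) \<in> (adj G)\<^sup>*" by (simp add: reach_def)
  then show "u \<in> verts G"
    by induction (use assms in \<open>auto simp: adj_def finite_multigraph_def\<close>)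
qed

text \<open>Used to keep vertices distinct when a walk is turned into a path: if the new first
  vertex already occurs, the path is cut there instead of prolonged.\<close>

lemma path_suffix:
  "is_path G (vs, es) \<Longrightarrow> x \<in> set vs \<Longrightarrow>
    \<exists>vs' es'. is_path G (vs', es') \<and> hd vs' = x \<and> last vs' = last vs"
proof (induction es arbitrary: vs)
  case Nil
  then show ?case by (intro exI[of _ vs] exI[of _ "[]"]) (auto simp: is_path_Nil)
next
  case (Cons e es)
  then obtain v ws where vs: "vs = v # ws" by (cases vs) auto
  show ?case
  proof (cases "x = v")
    case True
    then show ?thesis using Cons.prems vs by (intro exI[of _ vs] exI[of _ "e # es"]) simp
  next
    case False
    then show ?thesis using Cons vs by (simp add: is_path_Cons)
  qed
qed

lemma path_of_reachable:
  assumes "(u, v) \<in> (adj G)\<^sup>*" "v \<in> verts G" "\<forall>e\<in>edges G. ends G e \<subseteq> verts G"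
  shows "\<exists>vs es. is_path G (vs, es) \<and> hd vs = u \<and> last vs = v"
  using assms(1)
proof (induction rule: converse_rtrancl_induct)
  case base
  then show ?case using assms(2) by (intro exI[of _ "[v]"] exI[of _ "[]"]) (simp add: is_path_Nil)
next
  case (step x y)
  then obtain vs es where P: "is_path G (vs, es)" "hd vs = y" "last vs = v" by blast
  then have ne: "vs \<noteq> []" by (auto simp: is_path_def)
  obtain e where e: "e \<in> edges G" "ends G e = {x, y}" using step by (auto simp: adj_def)
  show ?case
  proof (cases "x \<in> set vs")
    case True
    then show ?thesis using path_suffix[OF P(1) True] P(3) by simp
  next
    case False
    then have "is_path G (x # vs, e # es)"
      using P ne e assms(3) by (auto simp: is_path_Cons)
    then show ?thesis using P(3) ne by (intro exI[of _ "x # vs"] exI[of _ "e # es"]) simp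
  qed
qed

lemma reachable_of_path: "is_path G (vs, es) \<Longrightarrow> (hd vs, last vs) \<in> (adj G)\<^sup>*"
proof (induction es arbitrary: vs)
  case Nil
  then show ?case by (auto simp: is_path_Nil)
next
  case (Cons e es)
  then obtain v ws where vs: "vs = v # ws" by (cases vs) (auto simp: is_path_def)
  then have "(v, hd ws) \<in> adj G" "(hd ws, last ws) \<in> (adj G)\<^sup>*" "ws \<noteq> []"
    using Cons by (auto simp: is_path_Cons adj_def)
  then show ?case by (simp add: vs converse_rtrancl_into_rtrancl)
qed

lemma comp_of_subgraph: "finite_multigraph G \<Longrightarrow> v \<in> verts G \<Longrightarrow> is_subgraph (comp_of G v) G"
  using reach_subset_verts[of G v] by (auto simp: is_subgraph_def comp_of_def)

lemma comp_of_connected: "connected_graph (comp_of G v)"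
proof -
  let ?C = "comp_of G v"
  have from_v: "(v, u) \<in> (adj ?C)\<^sup>*" if "(v, u) \<in> (adj G)\<^sup>*" for u
    using that
  proof induction
    case (step y z)
    then have "y \<in> reach G v" "z \<in> reach G v" by (auto simp: reach_def)
    then have "(y, z) \<in> adj ?C" using step.hyps(2) by (auto simp: adj_def comp_of_def)
    then show ?case using step.IH by simp
  qed simp
  have "\<exists>vs es. is_path ?C (vs, es) \<and> hd vs = u \<and> last vs = w"
    if "u \<in> verts ?C" "w \<in> verts ?C" for u w
  proof (rule path_of_reachable)
    show "(u, w) \<in> (adj ?C)\<^sup>*"
      using that from_v adj_sym[of v u ?C] by (auto simp: comp_of_def reach_def intro: rtrancl_trans)
  qed (use that in \<open>auto simp: comp_of_def\<close>)
  moreover have "v \<in> verts ?C" by (simp add: comp_of_def reach_self)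
  ultimately show ?thesis unfolding connected_graph_def by blast
qed

lemma connected_subgraph_of_comp_of:
  assumes D: "is_subgraph D G" "connected_graph D" "v \<in> verts D"
  shows "is_subgraph D (comp_of G v)"
proof -
  have "adj D \<subseteq> adj G" using D(1) by (auto simp: adj_def is_subgraph_def)
  have "verts D \<subseteq> reach G v"
  proof
    fix u assume "u \<in> verts D"
    then obtain vs es where "is_path D (vs, es)" "hd vs = v" "last vs = u"
      using D(2,3) unfolding connected_graph_def by blast
    then have "(v, u) \<in> (adj D)\<^sup>*" using reachable_of_path by metis
    then show "u \<in> reach G v"
      using rtrancl_mono[OF \<open>adj D \<subseteq> adj G\<close>] by (auto simp: reach_def)
  qed
  then show ?thesis using D(1) by (fastforce simp: is_subgraph_def comp_of_def)
qed

lemma is_subgraph_antisym: "is_subgraph H G \<Longrightarrow> is_subgraph G H \<Longrightarrow> G = H"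
  by (auto simp: is_subgraph_def intro!: multigraph.equality)

text \<open>\<open>comp_of G v\<close> contains every connected subgraph through \<open>v\<close>,
  so it is maximal; conversely a maximal connected subgraph has a vertex and coincides with
  \<open>comp_of\<close> of that vertex.\<close>

lemma components_eq:
  assumes G: "finite_multigraph G"
  shows "components G = comp_of G ` verts G"
proof (intro equalityI subsetI)
  fix C assume C: "C \<in> components G"
  then obtain v where v: "v \<in> verts C" by (auto simp: components_def connected_graph_def)
  then have "v \<in> verts G" using C by (auto simp: components_def is_subgraph_def)
  moreover have "is_subgraph C (comp_of G v)"
    using C v by (intro connected_subgraph_of_comp_of) (auto simp: components_def)
  then have "comp_of G v = C"
    using C comp_of_subgraph[OF G \<open>v \<in> verts G\<close>] comp_of_connected[of G v]
    by (simp add: components_def)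
  ultimately show "C \<in> comp_of G ` verts G" by blast
next
  fix C assume "C \<in> comp_of G ` verts G"
  then obtain v where v: "v \<in> verts G" "C = comp_of G v" by blast
  have "D = C" if D: "is_subgraph D G" "connected_graph D" "is_subgraph C D" for D
  proof -
    have "v \<in> verts C" by (simp add: v comp_of_def reach_self)
    then have "v \<in> verts D" using D(3) by (auto simp: is_subgraph_def)
    then have "is_subgraph D C" unfolding v(2) by (rule connected_subgraph_of_comp_of[OF D(1,2)])
    then show ?thesis using D(3) by (intro is_subgraph_antisym)
  qed
  then show "C \<in> components G"
    using comp_of_subgraph[OF G v(1)] comp_of_connected[of G v] by (simp add: components_def v(2))
qed

text \<open>A component is determined by its vertex set, so sums over components, which are records,
  become sums over reachability classes.\<close>

lemma sum_components:
  assumes G: "finite_multigraph G"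
  shows "(\<Sum>C\<in>components G. g (verts C)) = (\<Sum>K\<in>reach G ` verts G. g K)"
proof -
  have "inj_on verts (components G)"
    unfolding components_eq[OF G] by (auto intro!: inj_onI simp: comp_of_def)
  moreover have "verts ` components G = reach G ` verts G"
    unfolding components_eq[OF G] by (simp add: image_image comp_of_def)
  ultimately show ?thesis using sum.reindex[of verts "components G" g] by (simp add: comp_def)
qed

section \<open>Disjoint paths satisfy the bound\<close>

text \<open>The test on a single half-edge in \<open>graph_ST\<close>, kept apart because the two
  half-edges of one edge may fare differently.\<close>

definition good :: "('v, 'e) signing \<Rightarrow> 'v set \<Rightarrow> 'v set \<Rightarrow> 'v \<Rightarrow> 'e \<Rightarrow> bool" where
  "good \<sigma> S T v e \<longleftrightarrow>
     v \<notin> S \<union> T \<or> (v \<in> S - T \<and> \<sigma> v e = Minus) \<or> (v \<in> T - S \<and> \<sigma> v e = Plus)"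

lemma graph_ST_simps [simp]:
  "verts (graph_ST G \<sigma> S T) = verts G"
  "ends (graph_ST G \<sigma> S T) = ends G"
  "edges (graph_ST G \<sigma> S T) = {e\<in>edges G. \<forall>v\<in>ends G e. good \<sigma> S T v e}"
  by (simp_all add: graph_ST_def good_def)

lemma finite_graph_ST: "finite_multigraph G \<Longrightarrow> finite_multigraph (graph_ST G \<sigma> S T)"
  by (simp add: finite_multigraph_def)

lemma good_other_sign:
  "v \<notin> S \<inter> T \<Longrightarrow> \<not> good \<sigma> S T v e \<Longrightarrow> \<sigma> v e \<noteq> \<sigma> v e' \<Longrightarrow> good \<sigma> S T v e'"
  by (cases "\<sigma> v e"; cases "\<sigma> v e'") (auto simp: good_def)

text \<open>Cut the path at its vertices in \<open>X \<union> S \<union> T\<close>. At a cut vertex outside \<open>X\<close> exactly one of the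
  two half-edges of the path survives in \<open>B\<^bsub>S,T\<^esub>\<close>, and both half-edges at the ends of the path
  survive. So the first segment whose final half-edge survives lies in \<open>B\<^bsub>S,T\<^esub>\<close> as a whole.\<close>

lemma bipath_segment:
  assumes "X \<inter> S = X \<inter> T"
    and "is_bipath G \<sigma> (v # vs, es)" "es \<noteq> []" "good \<sigma> S T v (hd es)" "last (v # vs) \<in> X"
    and "set (v # vs) \<inter> (S \<inter> T) = {}" "a \<in> X \<union> S \<union> T" "a \<notin> set vs"
    and "(a, v) \<in> (adj (graph_ST G \<sigma> S T))\<^sup>*"
  shows "\<exists>x y. x \<noteq> y \<and> {x, y} \<subseteq> insert a (set vs) \<inter> (X \<union> S \<union> T) \<and>
    (x, y) \<in> (adj (graph_ST G \<sigma> S T))\<^sup>*"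
  using assms(2-)
\<comment> \<open>Here \<open>a\<close> is the latest cut vertex and \<open>v\<close> the current
  vertex, joined to \<open>a\<close> in \<open>graph_ST\<close>; the half-edge leaving
  \<open>v\<close> survives. That \<open>a\<close> does not occur in \<open>vs\<close> makes the two
  vertices found distinct.\<close>
proof (induction es arbitrary: v vs a)
  case (Cons e es)
  note prems = Cons.prems
  then obtain w ws where vs: "vs = w # ws" by (cases vs) (auto simp: is_bipath_Cons)
  have bp: "is_bipath G \<sigma> (w # ws, es)" and e: "e \<in> edges G" "ends G e = {v, w}"
    and sign: "es \<noteq> [] \<longrightarrow> \<sigma> w e \<noteq> \<sigma> w (hd es)"
    using prems(1) vs by (auto simp: is_bipath_Cons)
  have "w \<notin> set ws" using bp by (simp add: is_bipath_def is_path_def)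
  have final: "w \<in> X" if "es = []"
    using that bp prems(4) vs by (auto simp: is_bipath_def is_path_def)
  have wST: "w \<notin> S \<inter> T" using prems(5) vs by auto
  show ?case
  proof (cases "good \<sigma> S T w e")
    case True
    then have "(v, w) \<in> adj (graph_ST G \<sigma> S T)" using e prems(3) by (auto simp: adj_def)
    then have aw: "(a, w) \<in> (adj (graph_ST G \<sigma> S T))\<^sup>*" using prems(8) by simp
    show ?thesis
    proof (cases "w \<in> X \<union> S \<union> T")
      case True
      then show ?thesis using aw prems(6,7) vs by (intro exI[of _ a] exI[of _ w]) auto
    next
      case False
      then have "es \<noteq> []" "good \<sigma> S T w (hd es)" using final by (auto simp: good_def)
      then have "\<exists>x y. x \<noteq> y \<and> {x, y} \<subseteq> insert a (set ws) \<inter> (X \<union> S \<union> T) \<and>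
          (x, y) \<in> (adj (graph_ST G \<sigma> S T))\<^sup>*"
        using prems(4-7) vs by (intro Cons.IH[OF bp _ _ _ _ _ _ aw]) auto
      then show ?thesis using vs by auto
    qed
  next
    case False
    \<comment> \<open>The edge into \<open>w\<close> is lost at \<open>w\<close>, so
      \<open>w\<close> is a cut vertex. It is not in \<open>X\<close>, since
      \<open>X \<inter> S = X \<inter> T\<close> would put it into \<open>S \<inter> T\<close>.
      Hence the path continues, its next half-edge survives, and a new segment starts at
      \<open>w\<close>.\<close>
    then have "w \<in> S \<union> T" by (auto simp: good_def)
    then have "w \<notin> X" using wST assms(1) by blast
    then have "es \<noteq> []" using final by blast
    then have "good \<sigma> S T w (hd es)" using good_other_sign[OF wST False] sign by blast
    then have "\<exists>x y. x \<noteq> y \<and> {x, y} \<subseteq> insert w (set ws) \<inter> (X \<union> S \<union> T) \<and>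
        (x, y) \<in> (adj (graph_ST G \<sigma> S T))\<^sup>*"
      using prems(4-7) vs \<open>es \<noteq> []\<close> \<open>w \<notin> set ws\<close> \<open>w \<in> S \<union> T\<close> by (intro Cons.IH[OF bp]) auto
    then show ?thesis using vs by auto
  qed
qed simp

lemma X_path_segment:
  assumes XST: "X \<inter> S = X \<inter> T"
    and P: "is_X_path G \<sigma> X (vs, es)" "set vs \<inter> (S \<inter> T) = {}"
  shows "\<exists>x y. x \<noteq> y \<and> {x, y} \<subseteq> set vs \<inter> (X \<union> S \<union> T) \<and> y \<in> reach (graph_ST G \<sigma> S T) x"
proof -
  have bp: "is_bipath G \<sigma> (vs, es)" "es \<noteq> []" "hd vs \<in> X" "last vs \<in> X"
    using P by (auto simp: is_X_path_def)
  then obtain v ws where vs: "vs = v # ws" by (cases vs) (auto simp: is_bipath_def is_path_def)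
  have "v \<notin> set ws" using bp(1) vs by (auto simp: is_bipath_def is_path_def)
  \<comment> \<open>A vertex of \<open>X\<close> outside \<open>S \<inter> T\<close> lies in neither
    \<open>S\<close> nor \<open>T\<close>, so the first half-edge survives whatever its
    sign.\<close>
  moreover have "good \<sigma> S T v (hd es)" using bp(3) P(2) XST vs by (auto simp: good_def)
  ultimately have "\<exists>x y. x \<noteq> y \<and> {x, y} \<subseteq> insert v (set ws) \<inter> (X \<union> S \<union> T) \<and>
      (x, y) \<in> (adj (graph_ST G \<sigma> S T))\<^sup>*"
    using bp P(2) vs by (intro bipath_segment[OF XST]) auto
  then show ?thesis by (simp add: vs reach_def)
qed

text \<open>Disjoint paths meeting \<open>S \<inter> T\<close> use different vertices of it. Each
  remaining path claims two vertices of \<open>X \<union> S \<union> T\<close> in one component of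
  \<open>graph_ST\<close>, and disjoint paths claim disjoint pairs, so a component serves at most
  half as many paths as it has such vertices.\<close>

lemma card_disjoint_X_paths_le:
  assumes G: "finite_multigraph G" "S \<subseteq> verts G" "T \<subseteq> verts G" "X \<inter> S = X \<inter> T"
    and X: "X \<subseteq> verts G"
    and \<P>: "finite \<P>" "\<forall>P\<in>\<P>. is_X_path G \<sigma> X P" "disjoint_paths \<P>"
  shows "card \<P> \<le> card (S \<inter> T) +
    (\<Sum>C\<in>components (graph_ST G \<sigma> S T). card (verts C \<inter> (X \<union> S \<union> T)) div 2)"
proof -
  let ?H = "graph_ST G \<sigma> S T" and ?Y = "X \<union> S \<union> T"
  let ?\<K> = "reach ?H ` verts G"
  have finV: "finite (verts G)" using G by (simp add: finite_multigraph_def)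
  define hit where "hit = {P\<in>\<P>. set (fst P) \<inter> (S \<inter> T) \<noteq> {}}"
  define avd where "avd = {P\<in>\<P>. set (fst P) \<inter> (S \<inter> T) = {}}"
  have disj: "P = P'" if "P \<in> \<P>" "P' \<in> \<P>" "x \<in> set (fst P)" "x \<in> set (fst P')" for P P' x
    using \<P>(3) that unfolding disjoint_paths_def pairwise_def disjnt_def by blast
  have "\<exists>t. \<forall>P\<in>hit. t P \<in> set (fst P) \<inter> (S \<inter> T)"
    by (intro bchoice) (auto simp: hit_def)
  then obtain t where t: "\<forall>P\<in>hit. t P \<in> set (fst P) \<inter> (S \<inter> T)" by blast
  have "inj_on t hit"
  proof (rule inj_onI)
    fix P P' assume "P \<in> hit" "P' \<in> hit" "t P = t P'"
    then have "t P \<in> set (fst P)" "t P \<in> set (fst P')" using t by (metis IntD1)+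
    moreover have "P \<in> \<P>" "P' \<in> \<P>"
      using \<open>P \<in> hit\<close> \<open>P' \<in> hit\<close> by (simp_all add: hit_def)
    ultimately show "P = P'" using disj by blast
  qed
  then have "card hit \<le> card (S \<inter> T)"
    using t finite_subset[OF G(2) finV] by (intro card_inj_on_le[of t]) auto
  moreover have "card avd \<le> (\<Sum>K\<in>?\<K>. card (K \<inter> ?Y) div 2)"
  proof -
    have "\<exists>z. fst z \<noteq> snd z \<and> {fst z, snd z} \<subseteq> set (fst P) \<inter> ?Y \<and> snd z \<in> reach ?H (fst z)"
      if "P \<in> avd" for P
    proof -
      have "is_X_path G \<sigma> X (fst P, snd P)" "set (fst P) \<inter> (S \<inter> T) = {}"
        using that \<P>(2) by (auto simp: avd_def)
      from X_path_segment[OF G(4) this] show ?thesis by simp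
    qed
    then have "\<exists>z. \<forall>P\<in>avd. fst (z P) \<noteq> snd (z P) \<and> {fst (z P), snd (z P)} \<subseteq> set (fst P) \<inter> ?Y \<and>
        snd (z P) \<in> reach ?H (fst (z P))"
      by (intro bchoice) blast
    then obtain z where z: "\<And>P. P \<in> avd \<Longrightarrow> fst (z P) \<noteq> snd (z P)"
        "\<And>P. P \<in> avd \<Longrightarrow> {fst (z P), snd (z P)} \<subseteq> set (fst P) \<inter> ?Y"
        "\<And>P. P \<in> avd \<Longrightarrow> snd (z P) \<in> reach ?H (fst (z P))"
      by blast
    define g where "g P = reach ?H (fst (z P))" for P
    have fin: "finite avd" using \<P> by (simp add: avd_def)
    have "?Y \<subseteq> verts G" using G X by blast
    then have "fst (z P) \<in> verts G" if "P \<in> avd" for P using z(2)[OF that] by blast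
    then have "g ` avd \<subseteq> ?\<K>" unfolding g_def by blast
    then have "card avd = (\<Sum>K\<in>?\<K>. card {P\<in>avd. g P = K})"
      using sum.group[of avd ?\<K> g "\<lambda>_. 1::nat"] fin finV by simp
    also have "\<dots> \<le> (\<Sum>K\<in>?\<K>. card (K \<inter> ?Y) div 2)"
    proof (rule sum_mono)
      fix K
      let ?A = "{P\<in>avd. g P = K}"
      have "2 * card ?A = (\<Sum>P\<in>?A. card {fst (z P), snd (z P)})" using z(1) by simp
      also have "\<dots> = card (\<Union>P\<in>?A. {fst (z P), snd (z P)})"
      proof (rule card_UN_disjoint[symmetric])
        have "{fst (z P), snd (z P)} \<inter> {fst (z P'), snd (z P')} = {}"
          if "P \<in> ?A" "P' \<in> ?A" "P \<noteq> P'" for P P'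
        proof -
          have "set (fst P) \<inter> set (fst P') = {}"
            using that disj[of P P'] by (auto simp: avd_def)
          moreover have "{fst (z P), snd (z P)} \<subseteq> set (fst P)"
              "{fst (z P'), snd (z P')} \<subseteq> set (fst P')"
            using z(2) that by blast+
          ultimately show ?thesis by blast
        qed
        then show "\<forall>P\<in>?A. \<forall>P'\<in>?A. P \<noteq> P' \<longrightarrow>
            {fst (z P), snd (z P)} \<inter> {fst (z P'), snd (z P')} = {}" by blast
      qed (use fin in auto)
      also have "\<dots> \<le> card (K \<inter> ?Y)"
      proof (rule card_mono)
        show "finite (K \<inter> ?Y)" using finV \<open>?Y \<subseteq> verts G\<close> by (auto dest: finite_subset)
        show "(\<Union>P\<in>?A. {fst (z P), snd (z P)}) \<subseteq> K \<inter> ?Y"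
        proof
          fix x assume "x \<in> (\<Union>P\<in>?A. {fst (z P), snd (z P)})"
          then obtain P where P: "P \<in> avd" "g P = K" and x: "x = fst (z P) \<or> x = snd (z P)"
            by blast
          have "fst (z P) \<in> K" "snd (z P) \<in> K"
            using P z(3)[OF P(1)] reach_self[of "fst (z P)" ?H] by (simp_all add: g_def)
          then show "x \<in> K \<inter> ?Y" using z(2)[OF P(1)] x by blast
        qed
      qed
      finally show "card ?A \<le> card (K \<inter> ?Y) div 2" by linarith
    qed
    finally show ?thesis .
  qed
  moreover have "card \<P> = card hit + card avd"
    using \<P>(1) unfolding hit_def avd_def
    by (subst card_Un_disjoint[symmetric]) (auto intro: arg_cong[of _ _ card])
  ultimately show ?thesis
    using sum_components[OF finite_graph_ST[OF G(1)], of "\<lambda>K. card (K \<inter> ?Y) div 2" \<sigma> S T] by simp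
qed

section \<open>The bound yields disjoint paths\<close>

lemma link_is_X_path:
  assumes "link G \<sigma> (verts G - X) (X \<times> {Plus}) P"
  shows "is_X_path G \<sigma> X P"
proof -
  obtain vs es where P: "P = (vs, es)" by (cases P)
  have bp: "is_bipath G \<sigma> (vs, es)" and ne: "es \<noteq> []" and ends: "hd vs \<in> X" "last vs \<in> X"
    and inner: "set (butlast (tl vs)) \<subseteq> verts G - X"
    using assms by (auto simp: P link_def)
  have "vs ! i \<notin> X" if "0 < i" "i < length es" for i
  proof -
    have "length vs = Suc (length es)" using bp by (simp add: is_bipath_def is_path_def)
    then have "i - 1 < length (butlast (tl vs))" "butlast (tl vs) ! (i - 1) = vs ! i"
      using that by (auto simp: nth_butlast nth_tl)
    then have "vs ! i \<in> set (butlast (tl vs))" by (metis nth_mem)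
    then show ?thesis using inner by blast
  qed
  then show ?thesis using bp ne ends by (simp add: P is_X_path_def)
qed

text \<open>The sign condition is imposed at inner vertices only, and those of an
  \<open>X\<close>-path lie outside \<open>X\<close>.\<close>

lemma is_X_path_cong:
  assumes "\<And>v e. v \<notin> X \<Longrightarrow> \<sigma> v e = \<sigma>' v e" "is_X_path G \<sigma> X P"
  shows "is_X_path G \<sigma>' X P"
  using assms by (auto simp: is_X_path_def is_bipath_def split: prod.splits)

text \<open>A vertex of \<open>X\<close> lies in both \<open>S\<close> and \<open>T\<close> or in
  neither: all its half-edges fail the test, or all pass it, regardless of sign.\<close>

lemma graph_ST_cong:
  assumes "\<And>v e. v \<notin> X \<Longrightarrow> \<sigma> v e = \<sigma>' v e" "X \<inter> S = X \<inter> T"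
  shows "graph_ST G \<sigma> S T = graph_ST G \<sigma>' S T"
proof -
  have "good \<sigma> S T v e \<longleftrightarrow> good \<sigma>' S T v e" for v e
    using assms by (cases "v \<in> X") (auto simp: good_def)
  then show ?thesis unfolding graph_ST_def good_def by presburger
qed

lemma reach_isolated:
  assumes "w \<in> S \<inter> T"
  shows "reach (graph_ST G \<sigma> S T) w = {w}"
proof -
  have "(w, u) \<notin> adj (graph_ST G \<sigma> S T)" for u
    using assms by (auto simp: adj_def good_def)
  then show ?thesis by (auto simp: reach_def elim: converse_rtranclE)
qed

section \<open>The auxiliary graph of ports\<close>

definition ports :: "('v, 'e) multigraph \<Rightarrow> 'v set \<Rightarrow> ('v \<times> sign) set" where
  "ports G X = (verts G - X) \<times> UNIV \<union> X \<times> {Plus}"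

definition port_edges ::
  "('v, 'e) multigraph \<Rightarrow> ('v, 'e) signing \<Rightarrow> 'v set \<Rightarrow> ('v \<times> sign) set set" where
  "port_edges G \<sigma> X = {{p, q} | p q. p \<in> ports G X \<and> q \<in> ports G X \<and> p \<noteq> q \<and>
     (fst p = fst q \<or> (\<exists>e. port_edge G \<sigma> p q e))}"

text \<open>A vertex of \<open>X\<close> has only one port, which counts as its plus port and as its minus port.\<close>

definition plus_set :: "('v, 'e) multigraph \<Rightarrow> ('v \<times> sign) set \<Rightarrow> 'v set" where
  "plus_set G U = {v\<in>verts G. (v, Plus) \<in> U}"

definition minus_set :: "('v, 'e) multigraph \<Rightarrow> 'v set \<Rightarrow> ('v \<times> sign) set \<Rightarrow> 'v set" where
  "minus_set G X U = {v\<in>verts G. (v, if v \<in> X then Plus else Minus) \<in> U}"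

text \<open>Each edge of \<open>graph_ST\<close> joins two ports outside \<open>U\<close>, and two
  remaining ports of one vertex are joined by the edge between them. So a walk in
  \<open>graph_ST\<close> lifts to a walk among the remaining ports, along which \<open>f\<close> is
  constant.\<close>

lemma same_label_if_reachable:
  assumes G: "finite_multigraph G" and plus: "\<And>x e. x \<in> X \<Longrightarrow> \<sigma> x e = Plus"
    and S: "S = plus_set G U" and T: "T = minus_set G X U"
    and f: "\<And>p q. {p, q} \<in> port_edges G \<sigma> X \<Longrightarrow> p \<notin> U \<Longrightarrow> q \<notin> U \<Longrightarrow> f p = f q"
    and p: "p \<in> ports G X - U"
    and q: "q \<in> ports G X - U"
    and reach: "(fst p, fst q) \<in> (adj (graph_ST G \<sigma> S T))\<^sup>*"
  shows "f p = f q"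
proof -
  have same: "f p = f q" if "p \<in> ports G X - U" "q \<in> ports G X - U" "fst p = fst q" for p q
  proof (cases "p = q")
    case False
    then have "{p, q} \<in> port_edges G \<sigma> X" using that unfolding port_edges_def by blast
    then show ?thesis using f that by blast
  qed simp
  have "f p = f q'" if "(fst p, x) \<in> (adj (graph_ST G \<sigma> S T))\<^sup>*" "q' \<in> ports G X - U" "fst q' = x"
    for x q'
    using that
  proof (induction arbitrary: q')
    case base
    then show ?case by (intro same[OF p]) simp_all
  next
    case (step y z)
    obtain e where e: "e \<in> edges G" "ends G e = {y, z}" "good \<sigma> S T y e" "good \<sigma> S T z e"
      using step.hyps(2) by (auto simp: adj_def)
    then have yz: "y \<in> verts G" "z \<in> verts G" "y \<noteq> z"
      using G by (auto simp: finite_multigraph_def)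
    \<comment> \<open>Membership in \<open>S\<close> records that the plus port is deleted, and a
      surviving half-edge there has sign \<open>Minus\<close>; symmetrically for \<open>T\<close>.
      At \<open>X\<close> the assumption \<open>plus\<close> selects the single port.\<close>
    have port: "(u, \<sigma> u e) \<in> ports G X - U" if "good \<sigma> S T u e" "u \<in> verts G" for u
      using that plus[of u e]
      by (cases "u \<in> X"; cases "\<sigma> u e") (auto simp: good_def S T plus_set_def minus_set_def ports_def)
    have py: "(y, \<sigma> y e) \<in> ports G X - U" and pz: "(z, \<sigma> z e) \<in> ports G X - U"
      using port e yz by blast+
    have "f p = f (y, \<sigma> y e)" using py by (rule step.IH) simp
    also have "\<dots> = f (z, \<sigma> z e)"
    proof (rule f)
      have "port_edge G \<sigma> (y, \<sigma> y e) (z, \<sigma> z e) e" using e by (simp add: port_edge_def)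
      then show "{(y, \<sigma> y e), (z, \<sigma> z e)} \<in> port_edges G \<sigma> X"
        using py pz yz(3) unfolding port_edges_def by blast
    qed (use py pz in blast)+
    also have "\<dots> = f q'" by (rule same[OF pz step.prems(1)]) (simp add: step.prems(2))
    finally show ?case .
  qed
  then show ?thesis using reach q by blast
qed

text \<open>In a class avoiding \<open>S \<inter> T\<close>, every vertex of
  \<open>X \<union> S \<union> T\<close> keeps a port outside \<open>U\<close> and every other
  vertex keeps both of its ports. A class meeting \<open>S \<inter> T\<close> is a single isolated
  vertex, for which the left side is 0.\<close>

lemma half_class_le_half_ports:
  assumes G: "finite_multigraph G" and v: "v \<in> verts G" and X: "X \<subseteq> verts G"
    and S: "S = plus_set G U" and T: "T = minus_set G X U"
    and K: "K = reach (graph_ST G \<sigma> S T) v"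
  shows "card (K \<inter> (X \<union> S \<union> T)) div 2 + card (K - (X \<union> S \<union> T)) \<le>
    card {p\<in>ports G X - U. reach (graph_ST G \<sigma> S T) (fst p) = K} div 2"
proof (cases "K \<inter> (S \<inter> T) = {}")
  case True
  let ?Y = "X \<union> S \<union> T"
  \<comment> \<open>The port left at a vertex of the class in
    \<open>X \<union> S \<union> T\<close>. If \<open>u \<in> S\<close>, then \<open>u\<close> is
    outside \<open>T\<close>, hence outside \<open>X\<close>, so it does have a minus port.\<close>
  define r where "r u = (u, if u \<in> S then Minus else Plus)" for u
  have "K \<subseteq> verts G"
    using reach_subset_verts[OF finite_graph_ST[OF G]] v K by simp
  have fin: "finite (verts G)" using G by (simp add: finite_multigraph_def)
  then have finK: "finite K" using \<open>K \<subseteq> verts G\<close> by (rule finite_subset[rotated])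
  have XST: "X \<inter> S = X \<inter> T" using X by (auto simp: S T plus_set_def minus_set_def)
  have cls: "reach (graph_ST G \<sigma> S T) u = K" if "u \<in> K" for u
    using that unfolding K by (rule reach_eqI)
  have "r u \<in> ports G X - U" if "u \<in> K \<inter> ?Y" for u
    using that True XST \<open>K \<subseteq> verts G\<close>
    by (auto simp: r_def ports_def S T plus_set_def minus_set_def)
  moreover have "(u, a) \<in> ports G X - U" if "u \<in> K - ?Y" for u a
    using that \<open>K \<subseteq> verts G\<close>
    by (cases a) (auto simp: ports_def S T plus_set_def minus_set_def)
  ultimately have "r ` (K \<inter> ?Y) \<union> (K - ?Y) \<times> UNIV \<subseteq>
      {p\<in>ports G X - U. reach (graph_ST G \<sigma> S T) (fst p) = K}"
    using cls by (auto simp: r_def)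
  moreover have "finite (ports G X)"
    using fin X by (auto simp: ports_def UNIV_sign dest: finite_subset)
  ultimately have "card (r ` (K \<inter> ?Y) \<union> (K - ?Y) \<times> UNIV) \<le>
      card {p\<in>ports G X - U. reach (graph_ST G \<sigma> S T) (fst p) = K}"
    by (intro card_mono) auto
  moreover have "card (r ` (K \<inter> ?Y) \<union> (K - ?Y) \<times> (UNIV :: sign set)) =
      card (r ` (K \<inter> ?Y)) + card ((K - ?Y) \<times> (UNIV :: sign set))"
    using finK by (intro card_Un_disjoint) (auto simp: UNIV_sign r_def)
  moreover have "card (r ` (K \<inter> ?Y)) = card (K \<inter> ?Y)"
    by (intro card_image) (auto simp: inj_on_def r_def)
  moreover have "card ((K - ?Y) \<times> (UNIV :: sign set)) = 2 * card (K - ?Y)"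
    by (simp add: UNIV_sign card_cartesian_product)
  ultimately show ?thesis by linarith
next
  case False
  then obtain w where w: "w \<in> K" "w \<in> S \<inter> T" by blast
  then have "K = reach (graph_ST G \<sigma> S T) w" unfolding K using reach_eqI by metis
  then have "K = {w}" using reach_isolated[OF w(2)] by metis
  then show ?thesis using w by (simp add: insert_Diff_if)
qed

text \<open>The set \<open>U\<close> has at least \<open>card S + card (T - X)\<close> elements.
  Inclusion-exclusion for \<open>S - X\<close> and \<open>T - X\<close>, together with
  \<open>X \<inter> S = X \<inter> T\<close>, rewrites this number as
  \<open>card ((S \<union> T) - X) + card (S \<inter> T)\<close>.\<close>

lemma card_deleted_ports:
  assumes "finite V" "X \<subseteq> V" "S \<subseteq> V" "T \<subseteq> V" "X \<inter> S = X \<inter> T" "finite U"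
    and U: "S \<times> {Plus} \<union> (T - X) \<times> {Minus} \<subseteq> U"
  shows "card (V - X) + card (S \<inter> T) \<le> card U + card (V - (X \<union> S \<union> T))"
proof -
  have fin: "finite S" "finite T" "finite X" using assms by (auto intro: finite_subset)
  have "card S + card (T - X) = card (S \<times> {Plus} \<union> (T - X) \<times> {Minus})"
    using fin by (subst card_Un_disjoint) (auto simp: card_cartesian_product)
  also have "\<dots> \<le> card U" using assms by (intro card_mono)
  finally have 1: "card S + card (T - X) \<le> card U" .
  have "V - X = (V - (X \<union> S \<union> T)) \<union> ((S - X) \<union> (T - X))" using assms by auto
  then have 2: "card (V - X) \<le> card (V - (X \<union> S \<union> T)) + card ((S - X) \<union> (T - X))"
    by (metis card_Un_le)
  have 3: "card (S - X) + card (T - X) = card ((S - X) \<union> (T - X)) + card ((S - X) \<inter> (T - X))"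
    using fin by (intro card_Un_Int) auto
  have "S \<inter> T = ((S - X) \<inter> (T - X)) \<union> (S \<inter> X)" using assms by auto
  then have 4: "card (S \<inter> T) \<le> card ((S - X) \<inter> (T - X)) + card (S \<inter> X)"
    by (metis card_Un_le)
  have 5: "card S = card (S - X) + card (S \<inter> X)"
    using card_Int_Diff[OF fin(1), of X] by simp
  show ?thesis using 1 2 3 4 5 by linarith
qed

text \<open>The bound is used directly for the pair read off \<open>U\<close>. Tutte-Berge bounds
  \<open>card M\<close> below by \<open>card U\<close> plus halved label classes; passing to classes
  of \<open>graph_ST\<close> leaves at least the halved counts of
  \<open>X \<union> S \<union> T\<close> plus the number of vertices outside it. Counting deleted
  ports turns this into \<open>card (verts G - X) + k\<close>.\<close>

lemma linked_of_dual_bound: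
  assumes G: "finite_multigraph G" and X: "X \<subseteq> verts G"
    and plus: "\<And>x e. x \<in> X \<Longrightarrow> \<sigma> x e = Plus"
    and bound: "\<And>S T. S \<subseteq> verts G \<Longrightarrow> T \<subseteq> verts G \<Longrightarrow> X \<inter> S = X \<inter> T \<Longrightarrow>
      k \<le> card (S \<inter> T) +
        (\<Sum>C\<in>components (graph_ST G \<sigma> S T). card (verts C \<inter> (X \<union> S \<union> T)) div 2)"
  shows "linked G \<sigma> (verts G - X) (X \<times> {Plus}) k"
proof -
  let ?V = "verts G" and ?W = "ports G X" and ?E = "port_edges G \<sigma> X"
  have finV: "finite ?V" using G by (simp add: finite_multigraph_def)
  then have finX: "finite X" using X by (rule finite_subset[rotated])
  have finW: "finite ?W" using finV finX by (simp add: ports_def UNIV_sign)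
  have "\<forall>m\<in>?E. m \<subseteq> ?W \<and> card m = 2" by (auto simp: port_edges_def)
  from Tutte_Berge[OF finW this] obtain M U and f :: "'a \<times> sign \<Rightarrow> ('a \<times> sign) set" where
    M: "matching ?E M" and U: "U \<subseteq> ?W"
    and f: "\<forall>p q. {p, q} \<in> ?E \<and> p \<notin> U \<and> q \<notin> U \<longrightarrow> f p = f q"
    and le: "card U + (\<Sum>c\<in>f ` (?W - U). card {p\<in>?W - U. f p = c} div 2) \<le> card M"
    by blast
  define S where "S = plus_set G U"
  define T where "T = minus_set G X U"
  let ?Y = "X \<union> S \<union> T" and ?H = "graph_ST G \<sigma> S T"
  let ?\<K> = "reach ?H ` ?V"
  define h where "h p = reach ?H (fst p)" for p :: "'a \<times> sign"
  have ST: "S \<subseteq> ?V" "T \<subseteq> ?V" "X \<inter> S = X \<inter> T"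
    using X by (auto simp: S_def T_def plus_set_def minus_set_def)
  have "(\<Sum>K\<in>?\<K>. card (K \<inter> ?Y) div 2 + card (K - ?Y)) \<le>
      (\<Sum>K\<in>?\<K>. card {p\<in>?W - U. h p = K} div 2)"
    unfolding h_def
  proof (rule sum_mono)
    fix K assume "K \<in> ?\<K>"
    then obtain v where "v \<in> ?V" "K = reach ?H v" by blast
    then show "card (K \<inter> ?Y) div 2 + card (K - ?Y) \<le>
        card {p\<in>?W - U. reach ?H (fst p) = K} div 2"
      by (intro half_class_le_half_ports[OF G _ X S_def T_def])
  qed
  also have "\<dots> = (\<Sum>K\<in>h ` (?W - U). card {p\<in>?W - U. h p = K} div 2)"
  \<comment> \<open>Classes all of whose ports lie in \<open>U\<close> contribute 0.\<close>
  proof (rule sum.mono_neutral_right)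
    show "h ` (?W - U) \<subseteq> ?\<K>" using X by (auto simp: h_def ports_def)
    have "{p\<in>?W - U. h p = K} = {}" if "K \<notin> h ` (?W - U)" for K using that by auto
    then show "\<forall>K\<in>?\<K> - h ` (?W - U). card {p\<in>?W - U. h p = K} div 2 = 0"
      by (metis DiffD2 card.empty div_0)
  qed (use finV in simp)
  also have "\<dots> \<le> (\<Sum>c\<in>f ` (?W - U). card {p\<in>?W - U. f p = c} div 2)"
  proof (rule sum_div2_refine)
    fix p q assume pq: "p \<in> ?W - U" "q \<in> ?W - U" "h p = h q"
    then have pq': "(fst p, fst q) \<in> (adj ?H)\<^sup>*" by (simp add: h_def reach_eq_iff)
    have f': "f p = f q" if "{p, q} \<in> ?E" "p \<notin> U" "q \<notin> U" for p q using f that by blast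
    show "f p = f q"
      by (rule same_label_if_reachable[where \<sigma> = \<sigma> and X = X and f = f,
            OF G plus S_def T_def f' pq(1,2) pq'])
  qed (use finW in simp)
  finally have "(\<Sum>K\<in>?\<K>. card (K \<inter> ?Y) div 2) + (\<Sum>K\<in>?\<K>. card (K - ?Y)) + card U \<le> card M"
    using le by (simp add: sum.distrib)
  moreover have "(\<Sum>K\<in>?\<K>. card (K - ?Y)) = card (?V - ?Y)"
  proof -
    have sub: "K \<subseteq> ?V" if K: "K \<in> ?\<K>" for K
    proof -
      obtain v where "v \<in> ?V" "K = reach ?H v" using K by blast
      then show ?thesis using reach_subset_verts[OF finite_graph_ST[OF G], of v \<sigma> S T] by simp
    qed
    have "(\<Sum>K\<in>?\<K>. card (K - ?Y)) = card (\<Union>K\<in>?\<K>. K - ?Y)"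
    proof (rule card_UN_disjoint[symmetric])
      show "\<forall>K\<in>?\<K>. finite (K - ?Y)" using sub finV by (meson finite_Diff finite_subset)
      have "K = K'" if "K \<in> ?\<K>" "K' \<in> ?\<K>" "x \<in> K" "x \<in> K'" for K K' x
        using that reach_eqI[of x ?H] by auto
      then show "\<forall>K\<in>?\<K>. \<forall>K'\<in>?\<K>. K \<noteq> K' \<longrightarrow> (K - ?Y) \<inter> (K' - ?Y) = {}" by blast
    qed (use finV in simp)
    also have "(\<Union>K\<in>?\<K>. K - ?Y) = ?V - ?Y" using sub reach_self[of _ ?H] by blast
    finally show ?thesis .
  qed
  moreover have "card (?V - X) + card (S \<inter> T) \<le> card U + card (?V - ?Y)"
  proof (rule card_deleted_ports[OF finV X ST])
    show "finite U" using U finW by (rule finite_subset)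
    show "S \<times> {Plus} \<union> (T - X) \<times> {Minus} \<subseteq> U"
      by (auto simp: S_def T_def plus_set_def minus_set_def)
  qed
  moreover have "k \<le> card (S \<inter> T) + (\<Sum>K\<in>?\<K>. card (K \<inter> ?Y) div 2)"
    using bound[OF ST] sum_components[OF finite_graph_ST[OF G], of "\<lambda>K. card (K \<inter> ?Y) div 2" \<sigma> S T]
    by simp
  ultimately have size: "card (?V - X) + k \<le> card M" by linarith
  have ME: "M \<subseteq> ?E" "pairwise disjnt M" using M by (auto simp: matching_def)
  show ?thesis
  proof (rule linked_of_matching[OF _ _ _ _ _ ME(2) _ _ _ size])
    show "finite (?V - X)" "finite (X \<times> {Plus})" using finV finX by simp_all
    show "inj_on fst (X \<times> {Plus})" by (auto simp: inj_on_def)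
    show "fst ` (X \<times> {Plus}) \<inter> (?V - X) = {}" "fst ` (X \<times> {Plus}) \<union> (?V - X) \<subseteq> ?V"
      using X by auto
    show "\<forall>m\<in>M. card m = 2" using ME(1) by (auto simp: port_edges_def)
    show "\<Union>M \<subseteq> X \<times> {Plus} \<union> (?V - X) \<times> UNIV"
      using ME(1) by (fastforce simp: port_edges_def ports_def)
    fix p q assume "{p, q} \<in> M" "fst p \<noteq> fst q"
    then have "{p, q} \<in> ?E" using ME(1) by blast
    then obtain p' q' where "{p, q} = {p', q'}" "fst p' = fst q' \<or> (\<exists>e. port_edge G \<sigma> p' q' e)"
      unfolding port_edges_def by blast
    then have "p = p' \<and> q = q' \<or> p = q' \<and> q = p'" "\<exists>e. port_edge G \<sigma> p' q' e"
      using \<open>fst p \<noteq> fst q\<close> by (metis doubleton_eq_iff)+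
    moreover have "port_edge G \<sigma> q' p' e" if "port_edge G \<sigma> p' q' e" for e
      using that by (simp add: port_edge_def insert_commute)
    ultimately show "\<exists>e. port_edge G \<sigma> p q e" by blast
  qed
qed

theorem theorem3p1:
  fixes G :: "('v, 'e) multigraph" and \<sigma> :: "('v, 'e) signing" and X :: "'v set" and k :: nat
  assumes "finite_multigraph G" and "X \<subseteq> verts G"
  shows "(\<exists>\<P>. finite \<P> \<and> card \<P> = k \<and> (\<forall>P\<in>\<P>. is_X_path G \<sigma> X P) \<and> disjoint_paths \<P>) \<longleftrightarrow>
    (\<forall>S T. S \<subseteq> verts G \<and> T \<subseteq> verts G \<and> X \<inter> S = X \<inter> T \<longrightarrow>
       card (S \<inter> T)
         + (\<Sum>C\<in>components (graph_ST G \<sigma> S T). card (verts C \<inter> (X \<union> S \<union> T)) div 2) \<ge> k)"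
    (is "?paths \<longleftrightarrow> ?bound")
proof
  assume ?paths
  then obtain \<P> where "finite \<P>" "card \<P> = k" "\<forall>P\<in>\<P>. is_X_path G \<sigma> X P" "disjoint_paths \<P>"
    by blast
  then show ?bound
    using card_disjoint_X_paths_le[OF assms(1) _ _ _ assms(2), of _ _ \<P> \<sigma>] by simp
next
  assume bound: ?bound
  \<comment> \<open>The signs at \<open>X\<close> are normalised so that one port per vertex of
    \<open>X\<close> suffices. Neither \<open>X\<close>-paths nor \<open>graph_ST\<close> for pairs
    with \<open>X \<inter> S = X \<inter> T\<close> change.\<close>
  define \<sigma>' where "\<sigma>' v e = (if v \<in> X then Plus else \<sigma> v e)" for v e
  have cong: "\<sigma>' v e = \<sigma> v e" if "v \<notin> X" for v e using that by (simp add: \<sigma>'_def)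
  have "linked G \<sigma>' (verts G - X) (X \<times> {Plus}) k"
  proof (rule linked_of_dual_bound[OF assms])
    show "\<sigma>' x e = Plus" if "x \<in> X" for x e using that by (simp add: \<sigma>'_def)
    fix S T assume ST: "S \<subseteq> verts G" "T \<subseteq> verts G" "X \<inter> S = X \<inter> T"
    have "graph_ST G \<sigma>' S T = graph_ST G \<sigma> S T" using graph_ST_cong[of X \<sigma>' \<sigma>, OF cong ST(3)] .
    then show "k \<le> card (S \<inter> T) +
        (\<Sum>C\<in>components (graph_ST G \<sigma>' S T). card (verts C \<inter> (X \<union> S \<union> T)) div 2)"
      using bound ST by simp
  qed
  then obtain \<P> where \<P>: "finite \<P>" "card \<P> = k" "disjoint_paths \<P>"
      "\<forall>P\<in>\<P>. link G \<sigma>' (verts G - X) (X \<times> {Plus}) P"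
    by (auto simp: linked_def)
  have "is_X_path G \<sigma> X P" if "P \<in> \<P>" for P
  proof -
    have "is_X_path G \<sigma>' X P" using \<P>(4) that by (intro link_is_X_path) blast
    then show ?thesis by (rule is_X_path_cong[rotated]) (rule cong)
  qed
  then show ?paths using \<P> by blast
qed

end
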